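(* Let $B\subset\mathbb{R}^n$ be a bounded domain and let $\gamma\subset\mathbb{R}^n$ be a curve that satisfies the modified Kirillov-Tuy condition (with respect to $B$) and encompasses $B$. Let $f$ be a smooth compactly supported vector field (covariant $1$-tensor field) on $\mathbb{R}^n$ supported in $B$. Suppose that the transverse ray transforms $\mathcal{T}_if$, $i=1,\dots,n-1$, are known for all lines intersecting $\gamma$, i.e. that $\mathcal{T}_if(a,\xi)$ is known for all $a\in\gamma$, $\xi\in\mathbb{S}^{n-1}$ and $1\le i\le n-1$. Then $f$ can be uniquely reconstructed from these data; that is, if $f$ and $g$ are two smooth compactly supported vector fields supported in $B$ with $\mathcal{T}_if(a,\xi)=\mathcal{T}_ig(a,\xi)$ for all $a\in\gamma$, $\xi\in\mathbb{S}^{n-1}$ and $1\le i\le n-1$, then $f=g$.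
   Context: Here $n\ge2$. Frame. Each $\xi\in\mathbb{S}^{n-1}$ is written in hyperspherical coordinates $\varphi_1,\dots,\varphi_{n-2}\in[0,\pi]$, $\varphi_{n-1}\in[0,2\pi)$ as $\xi^1=\prod_{k=1}^{n-1}\sin\varphi_k$ and $\xi^j=\big(\prod_{k=1}^{n-j}\sin\varphi_k\big)\cos\varphi_{n-j+1}$ for $2\le j\le n$ (empty products are $1$; where the angles are not unique, fix any choice). For $1\le l\le n-1$ the vector $\eta_l\in\mathbb{R}^n$ associated with $\xi$ has components $\eta_l^1=\cos\varphi_l\prod_{k=l+1}^{n-1}\sin\varphi_k$; $\eta_l^j=\cos\varphi_l\big(\prod_{k=l+1}^{n-j}\sin\varphi_k\big)\cos\varphi_{n-j+1}$ for $2\le j\le n-l$; $\eta_l^{n-l+1}=-\sin\varphi_l$; and $\eta_l^j=0$ for $j>n-l+1$. Then $\{\xi,\eta_1,\dots,\eta_{n-1}\}$ is an orthonormal basis of $\mathbb{R}^n$. Transverse ray transform. For $1\le i\le n-1$, $\mathcal{T}_if(x,\xi)=\int_{\mathbb{R}}\langle f(x+t\xi),\eta_i\rangle\,dt=\int_{\mathbb{R}}\sum_{j=1}^n f_j(x+t\xi)\,\eta_i^j\,dt$. Modified Kirillov-Tuy condition (for the domain $B$). For $\omega\in\mathbb{S}^{n-1}$, $p\in\mathbb{R}$ let $H_{\omega,p}=\{x\in\mathbb{R}^n:\langle\omega,x\rangle=p\}$. The curve $\gamma$ satisfies the condition if for almost every hyperplane $H_{\omega,p}$ intersecting $B$ there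 are points $\gamma_1,\gamma_2\in H_{\omega,p}\cap\gamma$, depending locally smoothly on $(\omega,p)$, such that for almost every $x\in H_{\omega,p}\cap B$ the vectors $x-\gamma_1$ and $x-\gamma_2$ are linearly independent. Encompassing. A curve $\gamma$ encompasses a bounded domain $B$ if $\gamma\cap B=\emptyset$ and for each $a\in\gamma$ and $\xi\in\mathbb{R}^n\setminus\{0\}$ at most one of the rays $\{a+t\xi:t\ge0\}$, $\{a+t\xi:t\le0\}$ intersects $B$. *)

theory Defs
  imports "HOL-Analysis.Analysis"
begin

section \<open>Hyperspherical frame\<close>

text \<open>
  The coordinates of \<open>real ^ 'n\<close> are labelled \<open>1, \<dots>, CARD('n)\<close> by a bijection
  \<open>idx :: 'n \<Rightarrow> nat\<close>, so that \<open>x $ c\<close> is the component with upper index \<open>idx c\<close>.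
  A tuple of angles is a function \<open>\<phi> :: nat \<Rightarrow> real\<close> of which only the values at
  \<open>1, \<dots>, CARD('n) - 1\<close> matter.
\<close>

definition coordinate_labelling :: "('n::finite \<Rightarrow> nat) \<Rightarrow> bool" where
  "coordinate_labelling idx \<longleftrightarrow> bij_betw idx UNIV {1..CARD('n)}"

definition hyperspherical_angles :: "nat \<Rightarrow> (nat \<Rightarrow> real) \<Rightarrow> bool" where
  "hyperspherical_angles n \<phi> \<longleftrightarrow>
     (\<forall>k\<in>{1..n - 2}. 0 \<le> \<phi> k \<and> \<phi> k \<le> pi) \<and> 0 \<le> \<phi> (n - 1) \<and> \<phi> (n - 1) < 2 * pi"

definition hyperspherical_point :: "('n::finite \<Rightarrow> nat) \<Rightarrow> (nat \<Rightarrow> real) \<Rightarrow> real ^ 'n" where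
  "hyperspherical_point idx \<phi> =
     (\<chi> c. let n = CARD('n); j = idx c in
        if j = 1 then \<Prod>k=1..n - 1. sin (\<phi> k)
        else (\<Prod>k=1..n - j. sin (\<phi> k)) * cos (\<phi> (n - j + 1)))"

definition frame_vector :: "('n::finite \<Rightarrow> nat) \<Rightarrow> (nat \<Rightarrow> real) \<Rightarrow> nat \<Rightarrow> real ^ 'n" where
  "frame_vector idx \<phi> l =
     (\<chi> c. let n = CARD('n); j = idx c in
        if j = 1 then cos (\<phi> l) * (\<Prod>k=l + 1..n - 1. sin (\<phi> k))
        else if j \<le> n - l then
          cos (\<phi> l) * (\<Prod>k=l + 1..n - j. sin (\<phi> k)) * cos (\<phi> (n - j + 1))
        else if j = n - l + 1 then - sin (\<phi> l)
        else 0)"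

text \<open>A choice of angles for every unit vector; it is unconstrained where angles are not unique.\<close>

definition angle_choice :: "('n::finite \<Rightarrow> nat) \<Rightarrow> (real ^ 'n \<Rightarrow> nat \<Rightarrow> real) \<Rightarrow> bool" where
  "angle_choice idx ang \<longleftrightarrow>
     (\<forall>\<xi>\<in>sphere 0 1. hyperspherical_angles CARD('n) (ang \<xi>) \<and>
                      hyperspherical_point idx (ang \<xi>) = \<xi>)"


section \<open>Transverse ray transform\<close>

definition transverse_ray_transform ::
  "('n::finite \<Rightarrow> nat) \<Rightarrow> (real ^ 'n \<Rightarrow> nat \<Rightarrow> real) \<Rightarrow> nat
     \<Rightarrow> (real ^ 'n \<Rightarrow> real ^ 'n) \<Rightarrow> real ^ 'n \<Rightarrow> real ^ 'n \<Rightarrow> real" where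
  "transverse_ray_transform idx ang i f x \<xi> =
     (LINT t|lborel. f (x + t *\<^sub>R \<xi>) \<bullet> frame_vector idx (ang \<xi>) i)"


section \<open>Smooth functions\<close>

text \<open>Intended for open \<open>S\<close> in a finite-dimensional space, where this is the usual class \<open>C\<^sup>k\<close>.\<close>

fun Ck_on :: "nat \<Rightarrow> 'a::real_normed_vector set \<Rightarrow> ('a \<Rightarrow> 'b::real_normed_vector) \<Rightarrow> bool" where
  "Ck_on 0 S f \<longleftrightarrow> continuous_on S f"
| "Ck_on (Suc k) S f \<longleftrightarrow>
     (\<forall>x\<in>S. f differentiable (at x)) \<and> (\<forall>v. Ck_on k S (\<lambda>x. frechet_derivative f (at x) v))"

definition smooth_on :: "'a::real_normed_vector set \<Rightarrow> ('a \<Rightarrow> 'b::real_normed_vector) \<Rightarrow> bool" where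
  "smooth_on S f \<longleftrightarrow> (\<forall>k. Ck_on k S f)"

definition fun_support :: "('a::topological_space \<Rightarrow> 'b::zero) \<Rightarrow> 'a set" where
  "fun_support f = closure {x. f x \<noteq> 0}"


section \<open>Hyperplanes and their measures\<close>

definition hyperplane :: "'a::euclidean_space \<Rightarrow> real \<Rightarrow> 'a set" where
  "hyperplane \<omega> p = {x. \<omega> \<bullet> x = p}"

text \<open>
  Surface measure on the unit sphere, as \<open>DIM('a)\<close> times the normalised cone measure:
  a set \<open>A\<close> has measure \<open>DIM('a)\<close> times the volume of \<open>{r \<omega> | 0 < r < 1, \<omega> \<in> A}\<close>.
\<close>

definition sphere_measure :: "'a::euclidean_space measure" where
  "sphere_measure = scale_measure (of_nat DIM('a))
     (distr (restrict_space lborel (ball 0 1 - {0})) (restrict_space borel (sphere 0 1)) sgn)"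

text \<open>
  Lebesgue measure of dimension \<open>DIM('a) - 1\<close> on a hyperplane with unit normal \<open>\<omega>\<close>:
  the measure of a set is the volume of the cylinder of height \<open>1\<close> above it in direction \<open>\<omega>\<close>.
\<close>

definition hyperplane_measure :: "'a::euclidean_space \<Rightarrow> real \<Rightarrow> 'a measure" where
  "hyperplane_measure \<omega> p =
     distr (restrict_space lborel {x. p \<le> \<omega> \<bullet> x \<and> \<omega> \<bullet> x \<le> p + 1})
       (restrict_space borel (hyperplane \<omega> p)) (\<lambda>x. x - (\<omega> \<bullet> x - p) *\<^sub>R \<omega>)"


section \<open>Curves\<close>

definition is_curve :: "'a::topological_space set \<Rightarrow> bool" where
  "is_curve \<gamma> \<longleftrightarrow> (\<exists>(I :: real set) c. is_interval I \<and> continuous_on I c \<and> \<gamma> = c ` I)"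

text \<open>
  Without \<open>u \<noteq> v\<close> the set \<open>{u, v}\<close> would collapse to a singleton for \<open>u = v \<noteq> 0\<close>,
  which is independent.
\<close>

definition lin_indep_pair :: "'a::real_vector \<Rightarrow> 'a \<Rightarrow> bool" where
  "lin_indep_pair u v \<longleftrightarrow> u \<noteq> v \<and> independent {u, v}"

text \<open>
  Hyperplanes are parametrised by \<open>(\<omega>, p) \<in> sphere 0 1 \<times> \<real>\<close>. Smooth dependence on \<open>(\<omega>, p)\<close>
  near a point of this submanifold is expressed by smooth extensions to a neighbourhood \<open>U\<close>
  in the ambient space; the extensions are constrained only at unit vectors.
\<close>

definition modified_kirillov_tuy :: "'a::euclidean_space set \<Rightarrow> 'a set \<Rightarrow> bool" where
  "modified_kirillov_tuy B \<gamma> \<longleftrightarrow>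
     (AE (\<omega>, p) in sphere_measure \<Otimes>\<^sub>M lborel. hyperplane \<omega> p \<inter> B \<noteq> {} \<longrightarrow>
        (\<exists>U \<gamma>\<^sub>1 \<gamma>\<^sub>2. open U \<and> (\<omega>, p) \<in> U \<and> smooth_on U \<gamma>\<^sub>1 \<and> smooth_on U \<gamma>\<^sub>2 \<and>
           (\<forall>(\<omega>', p')\<in>U. norm \<omega>' = 1 \<longrightarrow>
              \<gamma>\<^sub>1 (\<omega>', p') \<in> hyperplane \<omega>' p' \<inter> \<gamma> \<and> \<gamma>\<^sub>2 (\<omega>', p') \<in> hyperplane \<omega>' p' \<inter> \<gamma>) \<and>
           (AE x in hyperplane_measure \<omega> p. x \<in> B \<longrightarrow>
              lin_indep_pair (x - \<gamma>\<^sub>1 (\<omega>, p)) (x - \<gamma>\<^sub>2 (\<omega>, p)))))"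

definition encompasses :: "'a::real_normed_vector set \<Rightarrow> 'a set \<Rightarrow> bool" where
  "encompasses \<gamma> B \<longleftrightarrow> \<gamma> \<inter> B = {} \<and>
     (\<forall>a\<in>\<gamma>. \<forall>\<xi>. \<xi> \<noteq> 0 \<longrightarrow>
        \<not> ({a + t *\<^sub>R \<xi> | t. 0 \<le> t} \<inter> B \<noteq> {} \<and> {a + t *\<^sub>R \<xi> | t. t \<le> 0} \<inter> B \<noteq> {}))"

end

theory Submission
  imports Defs
begin

text \<open>
  Let \<open>h = f - g\<close>, write \<open>n\<close> for the dimension and \<open>H\<^sub>m\<close> for the \<open>m\<close>-th derivative of \<open>h\<close> in a
  unit direction \<open>\<omega>\<close>. The frame vectors span the orthogonal complement of \<open>\<xi>\<close>, so equality of
  the data says that the integral of \<open>h\<close> along a line through a point \<open>a\<close> of the curve is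
  parallel to the line; because the curve encompasses the domain, the same holds for the integral
  \<open>X \<xi>\<close> along the ray from \<open>a\<close> in direction \<open>\<xi>\<close> (\<open>ray_integral_parallel\<close>).

  For \<open>v\<close> orthogonal to \<open>\<omega>\<close> this means \<open>(\<xi> \<bullet> v) * (X \<xi> \<bullet> \<omega>) = (\<xi> \<bullet> \<omega>) * (X \<xi> \<bullet> v)\<close>.
  Differentiating \<open>n - 1\<close> times in direction \<open>\<omega>\<close> at rays orthogonal to \<open>\<omega>\<close> and averaging over
  those rays gives an identity between integrals over the hyperplane \<open>P\<close> through \<open>a\<close> with normal
  \<open>\<omega>\<close>, namely \<open>\<integral>\<^sub>P ((x - a) \<bullet> v) * (H\<^sub>n\<^sub>-\<^sub>1 x \<bullet> \<omega>) = (n - 1) * \<integral>\<^sub>P H\<^sub>n\<^sub>-\<^sub>2 x \<bullet> v\<close>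
  (\<open>slice_identity\<close>). By the Kirillov-Tuy condition almost every hyperplane that meets the domain
  contains two distinct points of the curve. Comparing the identity at both points shows
  \<open>\<integral>\<^sub>P H\<^sub>n\<^sub>-\<^sub>1 x \<bullet> \<omega> = 0\<close>, and \<open>a\<close> drops out of the identity (\<open>two_point_elimination\<close>).

  Multiplying by \<open>exp (\<sigma> * p)\<close> and integrating over the parallel hyperplanes \<open>\<omega> \<bullet> x = p\<close> turns
  these into statements about the Laplace transform \<open>L k = \<integral> exp (k \<bullet> x) *\<^sub>R h x\<close> at
  \<open>k = \<sigma> *\<^sub>R \<omega>\<close>. The first says \<open>L k \<bullet> k = 0\<close>, that is, \<open>h\<close> is divergence free; the second,
  combined with the derivative of the first, says \<open>(n - 2) * (L k \<bullet> v) = 0\<close>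
  (\<open>vanishing_from_slice_equations\<close>). So \<open>L = 0\<close> if \<open>n \<ge> 3\<close>, and \<open>h = 0\<close> by Stone-Weierstrass
  (\<open>laplace_injective\<close>).

  In dimension \<open>2\<close> the conclusion \<open>(n - 2) * (L k \<bullet> v) = 0\<close> is void, and rotated gradients are
  indeed invisible to the data; but there the Kirillov-Tuy condition cannot hold, since two vectors
  in a line are linearly dependent (\<open>kirillov_tuy_dim\<close>).
\<close>

section \<open>The hyperspherical frame\<close>

text \<open>
  The scalar core of the frame computation. Here \<open>tail l\<close> is the part of the hyperspherical
  coordinates that involves only \<open>\<phi>\<^sub>l, \<phi>\<^sub>l\<^sub>+\<^sub>1, \<dots>\<close>, and \<open>T l\<close> pairs it with \<open>x\<close>. By
  construction \<open>T l = cos \<phi>\<^sub>l * x\<^sub>l + sin \<phi>\<^sub>l * T (l + 1)\<close>; orthogonality to the \<open>l\<close>-th frame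
  vector is the companion equation \<open>- sin \<phi>\<^sub>l * x\<^sub>l + cos \<phi>\<^sub>l * T (l + 1) = 0\<close>. Inverting
  this rotation gives \<open>x\<^sub>l = cos \<phi>\<^sub>l * T l\<close> and \<open>T (l + 1) = sin \<phi>\<^sub>l * T l\<close>, which unrolls to
  the coordinates of the point on the sphere.
\<close>

lemma telescoped_tail:
  fixes x \<phi> :: "nat \<Rightarrow> real" and n :: nat
  defines "tail l i \<equiv> (\<Prod>k=l..<i. sin (\<phi> k)) * (if i = n then 1 else cos (\<phi> i))"
  defines "T l \<equiv> \<Sum>i=l..n. x i * tail l i"
  assumes orth: "\<And>l. 1 \<le> l \<Longrightarrow> l < n \<Longrightarrow> - sin (\<phi> l) * x l + cos (\<phi> l) * T (Suc l) = 0"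
    and i: "1 \<le> i" "i \<le> n"
  shows "x i = T 1 * tail 1 i"
proof -
  have T_step: "T l = cos (\<phi> l) * x l + sin (\<phi> l) * T (Suc l)" if "l < n" for l
  proof -
    have "T l = x l * tail l l + (\<Sum>i=Suc l..n. x i * tail l i)"
      unfolding T_def using that by (simp add: sum.atLeast_Suc_atMost)
    also have "(\<Sum>i=Suc l..n. x i * tail l i) = sin (\<phi> l) * T (Suc l)"
      unfolding T_def tail_def sum_distrib_left
      by (intro sum.cong refl) (auto simp: prod.atLeast_Suc_lessThan)
    finally show ?thesis
      using that by (simp add: tail_def)
  qed
  have comp: "x l = cos (\<phi> l) * T l" and succ: "T (Suc l) = sin (\<phi> l) * T l"
    if "1 \<le> l" "l < n" for l
  proof -
    have "(sin (\<phi> l))\<^sup>2 + (cos (\<phi> l))\<^sup>2 = 1"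
      by simp
    then show "x l = cos (\<phi> l) * T l" "T (Suc l) = sin (\<phi> l) * T l"
      using orth[OF that] T_step[OF that(2)] by algebra+
  qed
  have prod: "T l = (\<Prod>k=1..<l. sin (\<phi> k)) * T 1" if "1 \<le> l" "l \<le> n" for l
    using that
  proof (induction l rule: dec_induct)
    case (step l)
    then show ?case
      using succ[of l] by simp
  qed simp
  show ?thesis
  proof (cases "i = n")
    case True
    have "T n = x n"
      by (simp add: T_def tail_def)
    then show ?thesis
      using prod[OF i] True by (simp add: tail_def)
  next
    case False
    then show ?thesis
      using prod[OF i] comp[of i] i by (simp add: tail_def)
  qed
qed

text \<open>
  The frame vectors span the orthogonal complement of the point, in the form in which the data
  use it: only multiples of the point are orthogonal to the whole frame. Coordinates are read in reverse order,
  \<open>r c = n + 1 - idx c\<close>, so that the angles enter in increasing order.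
\<close>

lemma parallel_if_orthogonal_to_frame:
  fixes X :: "real ^ 'n::finite"
  assumes idx: "coordinate_labelling idx"
    and orth: "\<And>l. l \<in> {1..CARD('n) - 1} \<Longrightarrow> X \<bullet> frame_vector idx \<phi> l = 0"
  shows "\<exists>c. X = c *\<^sub>R hyperspherical_point idx \<phi>"
proof -
  define n where "n = CARD('n)"
  define r where "r c = n + 1 - idx c" for c
  have bij_idx: "bij_betw idx UNIV {1..n}"
    using idx by (simp add: coordinate_labelling_def n_def)
  then have idx_range: "1 \<le> idx c" "idx c \<le> n" for c
    by (auto simp: bij_betw_def)
  have "bij_betw (\<lambda>j. n + 1 - j) {1..n} {1..n}"
    by (rule bij_betw_byWitness[where f' = "\<lambda>j. n + 1 - j"]) auto
  from bij_betw_trans[OF bij_idx this] have bij: "bij_betw r UNIV {1..n}"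
    by (simp add: r_def[abs_def] comp_def)
  then have r_range: "1 \<le> r c" "r c \<le> n" for c
    by (auto simp: bij_betw_def)
  define x where "x i = X $ (inv r i)" for i
  have x: "x (r c) = X $ c" for c
    using bij by (simp add: x_def bij_betw_def inv_f_f)
  define tail where "tail l i = (\<Prod>k=l..<i. sin (\<phi> k)) * (if i = n then 1 else cos (\<phi> i))"
    for l i
  define T where "T l = (\<Sum>i=l..n. x i * tail l i)" for l
  define comp where
    "comp l i = (if i < l then 0 else if i = l then - sin (\<phi> l) else cos (\<phi> l) * tail (Suc l) i)"
    for l i
  have point: "hyperspherical_point idx \<phi> $ c = tail 1 (r c)" for c
  proof -
    have *: "{1..n - idx c} = {1..<r c}" "{Suc 0..n - Suc 0} = {Suc 0..<n}"
      using idx_range[of c] by (auto simp: r_def)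
    have "r c = n \<longleftrightarrow> idx c = 1" "n - idx c + 1 = r c"
      using idx_range[of c] by (auto simp: r_def)
    then show ?thesis
      using * by (auto simp: hyperspherical_point_def Let_def tail_def simp flip: n_def)
  qed
  have frame: "frame_vector idx \<phi> l $ c = comp l (r c)" if "1 \<le> l" "l < n" for c l
  proof -
    have *: "{Suc l..n - idx c} = {Suc l..<r c}" "{Suc l..n - Suc 0} = {Suc l..<n}"
      using idx_range[of c] that by (auto simp: r_def)
    have "r c = n \<longleftrightarrow> idx c = 1" "n - idx c + 1 = r c" "idx c \<le> n - l \<longleftrightarrow> l < r c"
      "idx c = n - l + 1 \<longleftrightarrow> r c = l"
      using idx_range[of c] that by (auto simp: r_def)
    then show ?thesis
      using * that by (auto simp: frame_vector_def Let_def comp_def tail_def simp flip: n_def)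
  qed
  have orth': "- sin (\<phi> l) * x l + cos (\<phi> l) * T (Suc l) = 0" if l: "1 \<le> l" "l < n" for l
  proof -
    have "X \<bullet> frame_vector idx \<phi> l = (\<Sum>c\<in>UNIV. x (r c) * comp l (r c))"
      by (simp add: inner_vec_def x frame[OF l])
    also have "\<dots> = (\<Sum>i\<in>{1..n}. x i * comp l i)"
      by (rule sum.reindex_bij_betw[OF bij])
    also have "\<dots> = (\<Sum>i\<in>{l..n}. x i * comp l i)"
      using l by (intro sum.mono_neutral_right) (auto simp: comp_def)
    also have "\<dots> = x l * comp l l + (\<Sum>i=Suc l..n. x i * comp l i)"
      using l by (simp add: sum.atLeast_Suc_atMost)
    also have "(\<Sum>i=Suc l..n. x i * comp l i) = cos (\<phi> l) * T (Suc l)"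
      unfolding T_def sum_distrib_left by (intro sum.cong) (auto simp: comp_def)
    finally show ?thesis
      using orth[of l] l by (simp add: comp_def n_def)
  qed
  have "x i = T 1 * tail 1 i" if "1 \<le> i" "i \<le> n" for i
    unfolding T_def tail_def
    by (rule telescoped_tail) (use that orth' in \<open>auto simp: T_def tail_def\<close>)
  then have "X = T 1 *\<^sub>R hyperspherical_point idx \<phi>"
    using r_range by (simp add: vec_eq_iff point flip: x)
  then show ?thesis
    by blast
qed

section \<open>Integrals depending on a parameter\<close>

lemma has_real_derivative_integral:
  fixes F F' :: "real \<Rightarrow> 'z \<Rightarrow> real"
  assumes int: "\<And>s. integrable N (F s)"
    and meas: "F' s0 \<in> borel_measurable N"
    and deriv: "\<And>s z. ((\<lambda>s. F s z) has_real_derivative F' s z) (at s)"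
    and bound: "\<And>s z. \<bar>s - s0\<bar> < 1 \<Longrightarrow> \<bar>F' s z\<bar> \<le> g z"
    and g: "integrable N g"
  shows "((\<lambda>s. \<integral>z. F s z \<partial>N) has_real_derivative (\<integral>z. F' s0 z \<partial>N)) (at s0)"
proof -
  \<comment> \<open>The mean value theorem turns the bound on the derivative into one on difference quotients.\<close>
  have quot: "\<bar>(F (s0 + h) z - F s0 z) / h\<bar> \<le> g z" if "h \<noteq> 0" "\<bar>h\<bar> < 1" for h z
  proof -
    have "norm (F (s0 + h) z - F s0 z) \<le> g z * norm (s0 + h - s0)"
    proof (rule field_differentiable_bound[where S = "ball s0 1"])
      show "((\<lambda>s. F s z) has_field_derivative F' s z) (at s within ball s0 1)" for s
        using deriv has_field_derivative_at_within by blast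
      show "norm (F' s z) \<le> g z" if "s \<in> ball s0 1" for s
        using bound[of s z] that by (simp add: dist_real_def abs_minus_commute)
    qed (use that in \<open>auto simp: dist_real_def\<close>)
    then show ?thesis
      using that by (simp add: field_simps)
  qed
  have "(\<lambda>n. ((\<integral>z. F (s0 + S n) z \<partial>N) - (\<integral>z. F s0 z \<partial>N)) / S n) \<longlonglongrightarrow> (\<integral>z. F' s0 z \<partial>N)"
    if S: "\<And>n. S n \<noteq> 0" "S \<longlonglongrightarrow> 0" for S :: "nat \<Rightarrow> real"
  proof -
    from S(2) obtain n0 where n0: "\<And>n. n \<ge> n0 \<Longrightarrow> \<bar>S n\<bar> < 1"
      by (metis LIMSEQ_iff diff_zero real_norm_def zero_less_one)
    have "(\<lambda>n. \<integral>z. (F (s0 + S (n + n0)) z - F s0 z) / S (n + n0) \<partial>N) \<longlonglongrightarrow> (\<integral>z. F' s0 z \<partial>N)"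
    proof (rule integral_dominated_convergence[where w = g])
      show "(\<lambda>z. (F (s0 + S (n + n0)) z - F s0 z) / S (n + n0)) \<in> borel_measurable N" for n
        using int by (intro borel_measurable_divide borel_measurable_diff) auto
      show "AE z in N. (\<lambda>n. (F (s0 + S (n + n0)) z - F s0 z) / S (n + n0)) \<longlonglongrightarrow> F' s0 z"
      proof (rule AE_I2)
        fix z
        have "((\<lambda>h. (F (s0 + h) z - F s0 z) / h) \<longlongrightarrow> F' s0 z) (at 0)"
          using deriv[of z s0] by (simp add: DERIV_def)
        then have "(\<lambda>n. (F (s0 + S n) z - F s0 z) / S n) \<longlonglongrightarrow> F' s0 z"
          using S unfolding LIMSEQ_SEQ_conv[symmetric] by blast
        then show "(\<lambda>n. (F (s0 + S (n + n0)) z - F s0 z) / S (n + n0)) \<longlonglongrightarrow> F' s0 z"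
          by (rule LIMSEQ_ignore_initial_segment)
      qed
      show "AE z in N. norm ((F (s0 + S (n + n0)) z - F s0 z) / S (n + n0)) \<le> g z" for n
        using quot[OF S(1) n0] by (intro AE_I2) simp
    qed (use meas g in auto)
    then have "(\<lambda>n. ((\<integral>z. F (s0 + S (n + n0)) z \<partial>N) - (\<integral>z. F s0 z \<partial>N)) / S (n + n0))
        \<longlonglongrightarrow> (\<integral>z. F' s0 z \<partial>N)"
      using int by (simp add: Bochner_Integration.integral_diff)
    then show ?thesis
      by (rule LIMSEQ_offset)
  qed
  then show ?thesis
    unfolding DERIV_def LIMSEQ_SEQ_conv[symmetric] by blast
qed

section \<open>Integration over hyperplanes\<close>

text \<open>
  Lebesgue measure on the linear hyperplane orthogonal to a unit vector, carried as a measure on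
  the whole space: the volume of the slab of height \<open>1\<close> above a set. Every hyperplane
  \<open>\<omega> \<bullet> x = p\<close> is then reached by translating the integrand by \<open>p *\<^sub>R \<omega>\<close>.
\<close>

definition slice :: "'a::euclidean_space \<Rightarrow> 'a measure" where
  "slice \<omega> = distr (density lborel (\<lambda>x. indicator {0..1} (\<omega> \<bullet> x))) borel
     (\<lambda>x. x - (\<omega> \<bullet> x) *\<^sub>R \<omega>)"

lemma sets_slice [simp, measurable_cong]: "sets (slice \<omega>) = sets borel"
  and space_slice [simp]: "space (slice \<omega>) = UNIV"
  by (simp_all add: slice_def)

lemma nn_integral_slice:
  assumes [measurable]: "F \<in> borel_measurable borel"
  shows "(\<integral>\<^sup>+y. F y \<partial>slice \<omega>) =
    (\<integral>\<^sup>+x. indicator {0..1} (\<omega> \<bullet> x) * F (x - (\<omega> \<bullet> x) *\<^sub>R \<omega>) \<partial>lborel)"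
  unfolding slice_def by (simp add: nn_integral_distr nn_integral_density)

lemma nn_integral_lborel_translate:
  fixes u :: "'a::euclidean_space"
  assumes [measurable]: "F \<in> borel_measurable borel"
  shows "(\<integral>\<^sup>+x. F (x + u) \<partial>lborel) = (\<integral>\<^sup>+x. F x \<partial>lborel)"
proof -
  have "(\<integral>\<^sup>+x. F x \<partial>lborel) = (\<integral>\<^sup>+x. F x \<partial>distr lborel borel ((+) u))"
    by (simp add: lborel_distr_plus)
  also have "\<dots> = (\<integral>\<^sup>+x. F (x + u) \<partial>lborel)"
    by (subst nn_integral_distr) (simp_all add: add.commute)
  finally show ?thesis ..
qed

lemma nn_integral_lborel_dilate:
  fixes F :: "'a::euclidean_space \<Rightarrow> ennreal"
  assumes [measurable]: "F \<in> borel_measurable borel" and c: "c > 0"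
  shows "(\<integral>\<^sup>+x. F x \<partial>lborel) = ennreal (c ^ DIM('a)) * (\<integral>\<^sup>+x. F (c *\<^sub>R x) \<partial>lborel)"
  by (subst lborel_affine[of c 0])
    (use c in \<open>simp_all add: nn_integral_density nn_integral_distr nn_integral_cmult\<close>)

lemma AE_slice_orthogonal:
  assumes "norm \<omega> = 1"
  shows "AE y in slice \<omega>. \<omega> \<bullet> y = 0"
proof -
  have "\<omega> \<bullet> (x - (\<omega> \<bullet> x) *\<^sub>R \<omega>) = 0" for x
    using assms by (simp add: inner_diff_right dot_square_norm)
  then show ?thesis
    unfolding slice_def by (subst AE_distr_iff) (auto intro!: AE_I2)
qed

text \<open>
  Fubini for the foliation by parallel hyperplanes, without choosing orthogonal coordinates. The
  weight \<open>indicator {0..1} (\<omega> \<bullet> x)\<close> has integral \<open>1\<close> along each line in direction \<open>\<omega>\<close>, so it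
  suffices to move it by translations: first along the inner line, then in the whole space.
\<close>

lemma nn_integral_lborel_slice:
  fixes F :: "'a::euclidean_space \<Rightarrow> ennreal"
  assumes [measurable]: "F \<in> borel_measurable borel" and \<omega>: "norm \<omega> = 1"
  shows "(\<integral>\<^sup>+x. F x \<partial>lborel) = (\<integral>\<^sup>+p. \<integral>\<^sup>+y. F (y + p *\<^sub>R \<omega>) \<partial>slice \<omega> \<partial>lborel)"
proof -
  let ?\<chi> = "\<lambda>q. indicator {0..1::real} q :: ennreal"
  have "(\<integral>\<^sup>+p. \<integral>\<^sup>+y. F (y + p *\<^sub>R \<omega>) \<partial>slice \<omega> \<partial>lborel)
      = (\<integral>\<^sup>+p. \<integral>\<^sup>+x. ?\<chi> (\<omega> \<bullet> x) * F (x + (p + - (\<omega> \<bullet> x)) *\<^sub>R \<omega>) \<partial>lborel \<partial>lborel)"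
    by (subst nn_integral_slice) (auto simp: algebra_simps)
  also have "\<dots> = (\<integral>\<^sup>+x. \<integral>\<^sup>+p. ?\<chi> (\<omega> \<bullet> x) * F (x + (p + - (\<omega> \<bullet> x)) *\<^sub>R \<omega>) \<partial>lborel \<partial>lborel)"
    by (rule lborel_pair.Fubini') measurable
  also have "\<dots> = (\<integral>\<^sup>+x. \<integral>\<^sup>+p. ?\<chi> (\<omega> \<bullet> x) * F (x + p *\<^sub>R \<omega>) \<partial>lborel \<partial>lborel)"
    by (intro nn_integral_cong
        nn_integral_lborel_translate[where F = "\<lambda>p. ?\<chi> (\<omega> \<bullet> _) * F (_ + p *\<^sub>R \<omega>)"]) measurable
  also have "\<dots> = (\<integral>\<^sup>+p. \<integral>\<^sup>+x. ?\<chi> (\<omega> \<bullet> x) * F (x + p *\<^sub>R \<omega>) \<partial>lborel \<partial>lborel)"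
    by (rule lborel_pair.Fubini'[symmetric]) measurable
  also have "\<dots> = (\<integral>\<^sup>+p. \<integral>\<^sup>+x. ?\<chi> (\<omega> \<bullet> (x + p *\<^sub>R \<omega>) - p) * F (x + p *\<^sub>R \<omega>) \<partial>lborel \<partial>lborel)"
    using \<omega> by (simp add: inner_add_right dot_square_norm)
  also have "\<dots> = (\<integral>\<^sup>+p. \<integral>\<^sup>+x. ?\<chi> (\<omega> \<bullet> x - p) * F x \<partial>lborel \<partial>lborel)"
    by (intro nn_integral_cong
        nn_integral_lborel_translate[where F = "\<lambda>x. ?\<chi> (\<omega> \<bullet> x - _) * F x"]) measurable
  also have "\<dots> = (\<integral>\<^sup>+x. \<integral>\<^sup>+p. ?\<chi> (\<omega> \<bullet> x - p) * F x \<partial>lborel \<partial>lborel)"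
    by (rule lborel_pair.Fubini') measurable
  also have "\<dots> = (\<integral>\<^sup>+x. F x \<partial>lborel)"
  proof (intro nn_integral_cong)
    fix x
    have "(\<integral>\<^sup>+p. ?\<chi> (\<omega> \<bullet> x - p) * F x \<partial>lborel) = (\<integral>\<^sup>+p. indicator {\<omega> \<bullet> x - 1..\<omega> \<bullet> x} p * F x \<partial>lborel)"
      by (intro nn_integral_cong) (auto split: split_indicator)
    then show "(\<integral>\<^sup>+p. ?\<chi> (\<omega> \<bullet> x - p) * F x \<partial>lborel) = F x"
      by (simp add: nn_integral_multc)
  qed
  finally show ?thesis ..
qed

text \<open>
  Dilation by \<open>t\<close> turns the slab of height \<open>1\<close> into one of height \<open>t\<close>; this uses up one of the
  \<open>DIM('a)\<close> factors \<open>t\<close> of the volume, which leaves the Jacobian of the hyperplane.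
\<close>

lemma nn_integral_slice_dilate:
  fixes F :: "'a::euclidean_space \<Rightarrow> ennreal"
  assumes [measurable]: "F \<in> borel_measurable borel" and \<omega>: "norm \<omega> = 1" and t: "t > 0"
  shows "ennreal (t ^ (DIM('a) - 1)) * (\<integral>\<^sup>+y. F (t *\<^sub>R y) \<partial>slice \<omega>) = (\<integral>\<^sup>+y. F y \<partial>slice \<omega>)"
proof -
  let ?P = "\<lambda>x. x - (\<omega> \<bullet> x) *\<^sub>R \<omega>"
  let ?\<chi> = "\<lambda>q. indicator {0..t} q :: ennreal"
  have dim: "t ^ DIM('a) = t * t ^ (DIM('a) - 1)"
    by (metis DIM_positive power_eq_if less_numeral_extra(3))
  have "ennreal t * (ennreal (t ^ (DIM('a) - 1)) * (\<integral>\<^sup>+y. F (t *\<^sub>R y) \<partial>slice \<omega>))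
      = ennreal (t ^ DIM('a)) * (\<integral>\<^sup>+x. indicator {0..1} (\<omega> \<bullet> x) * F (t *\<^sub>R ?P x) \<partial>lborel)"
    using t by (simp add: nn_integral_slice dim ennreal_mult mult.assoc)
  also have "\<dots> = ennreal (t ^ DIM('a)) * (\<integral>\<^sup>+x. ?\<chi> (\<omega> \<bullet> (t *\<^sub>R x)) * F (?P (t *\<^sub>R x)) \<partial>lborel)"
    using t by (intro arg_cong2[where f = "(*)"] refl nn_integral_cong)
      (auto simp: algebra_simps zero_le_mult_iff split: split_indicator)
  also have "\<dots> = (\<integral>\<^sup>+x. ?\<chi> (\<omega> \<bullet> x) * F (?P x) \<partial>lborel)"
    by (rule nn_integral_lborel_dilate[symmetric]) (use t in auto)
  also have "\<dots> = (\<integral>\<^sup>+p. \<integral>\<^sup>+y. ?\<chi> (\<omega> \<bullet> (y + p *\<^sub>R \<omega>)) * F (?P (y + p *\<^sub>R \<omega>)) \<partial>slice \<omega> \<partial>lborel)"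
    by (rule nn_integral_lborel_slice) (use \<omega> in auto)
  also have "\<dots> = (\<integral>\<^sup>+p. \<integral>\<^sup>+y. ?\<chi> p * F y \<partial>slice \<omega> \<partial>lborel)"
    using AE_slice_orthogonal[OF \<omega>] \<omega>
    by (intro nn_integral_cong nn_integral_cong_AE)
      (auto simp: inner_add_right dot_square_norm algebra_simps)
  also have "\<dots> = ennreal t * (\<integral>\<^sup>+y. F y \<partial>slice \<omega>)"
    using t by (simp add: nn_integral_cmult nn_integral_multc)
  finally show ?thesis
    using t by (simp add: ennreal_mult_cancel_left)
qed

lemma distr_slice_translate:
  assumes u: "\<omega> \<bullet> u = 0"
  shows "distr (slice \<omega>) borel (\<lambda>y. y + u) = slice \<omega>"
proof (rule measure_eqI)
  fix A assume "A \<in> sets (distr (slice \<omega>) borel (\<lambda>y. y + u))"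
  then have [measurable]: "A \<in> sets borel"
    by simp
  have "emeasure (distr (slice \<omega>) borel (\<lambda>y. y + u)) A
      = (\<integral>\<^sup>+y. indicator A y \<partial>distr (slice \<omega>) borel (\<lambda>y. y + u))"
    by simp
  also have "\<dots> = (\<integral>\<^sup>+y. indicator A (y + u) \<partial>slice \<omega>)"
    by (subst nn_integral_distr) auto
  also have "\<dots> = (\<integral>\<^sup>+x. indicator {0..1} (\<omega> \<bullet> (x + u))
      * indicator A ((x + u) - (\<omega> \<bullet> (x + u)) *\<^sub>R \<omega>) \<partial>lborel)"
    by (subst nn_integral_slice) (auto simp: u inner_add_right algebra_simps)
  also have "\<dots> = (\<integral>\<^sup>+x. indicator {0..1} (\<omega> \<bullet> x) * indicator A (x - (\<omega> \<bullet> x) *\<^sub>R \<omega>) \<partial>lborel)"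
    by (rule nn_integral_lborel_translate) measurable
  also have "\<dots> = (\<integral>\<^sup>+y. indicator A y \<partial>slice \<omega>)"
    by (rule nn_integral_slice[symmetric]) measurable
  finally show "emeasure (distr (slice \<omega>) borel (\<lambda>y. y + u)) A = emeasure (slice \<omega>) A"
    by simp
qed simp

lemma integral_slice_translate:
  fixes G :: "'a::euclidean_space \<Rightarrow> real"
  assumes "\<omega> \<bullet> u = 0" and "G \<in> borel_measurable borel"
  shows "(\<integral>y. G (y + u) \<partial>slice \<omega>) = (\<integral>y. G y \<partial>slice \<omega>)"
proof -
  have "(\<integral>y. G y \<partial>slice \<omega>) = (\<integral>y. G y \<partial>distr (slice \<omega>) borel (\<lambda>y. y + u))"
    by (simp add: distr_slice_translate assms)
  then show ?thesis
    by (subst (asm) integral_distr) (use assms in auto)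
qed

lemma emeasure_slice_cball_finite:
  fixes \<omega> :: "'a::euclidean_space"
  assumes \<omega>: "norm \<omega> = 1"
  shows "emeasure (slice \<omega>) (cball 0 r) < \<infinity>"
proof -
  have "emeasure (slice \<omega>) (cball 0 r) = (\<integral>\<^sup>+y. indicator (cball 0 r) y \<partial>slice \<omega>)"
    by simp
  also have "\<dots> = (\<integral>\<^sup>+x. indicator {0..1} (\<omega> \<bullet> x) * indicator (cball 0 r) (x - (\<omega> \<bullet> x) *\<^sub>R \<omega>) \<partial>lborel)"
    by (rule nn_integral_slice) (intro borel_measurable_indicator, simp)
  also have "\<dots> \<le> (\<integral>\<^sup>+x. indicator (cball 0 (r + 1) :: 'a set) x \<partial>lborel)"
  proof (intro nn_integral_mono)
    fix x :: 'a
    have "norm x \<le> norm (x - (\<omega> \<bullet> x) *\<^sub>R \<omega>) + \<bar>\<omega> \<bullet> x\<bar>"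
      using norm_triangle_ineq[of "x - (\<omega> \<bullet> x) *\<^sub>R \<omega>" "(\<omega> \<bullet> x) *\<^sub>R \<omega>"] \<omega> by simp
    then show "indicator {0..1} (\<omega> \<bullet> x) * indicator (cball 0 r) (x - (\<omega> \<bullet> x) *\<^sub>R \<omega>)
        \<le> (indicator (cball 0 (r + 1)) x :: ennreal)"
      by (cases "\<omega> \<bullet> x \<in> {0..1}"; cases "norm (x - (\<omega> \<bullet> x) *\<^sub>R \<omega>) \<le> r") auto
  qed
  also have "\<dots> < \<infinity>"
    by (simp add: emeasure_bounded_finite del: infinity_ennreal_def)
  finally show ?thesis .
qed

lemma sigma_finite_slice:
  assumes "norm \<omega> = 1"
  shows "sigma_finite_measure (slice \<omega>)"
proof
  let ?A = "range (\<lambda>n. cball 0 (real n) :: 'a set)"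
  have "\<Union> ?A = UNIV"
    by (auto intro: real_arch_simple)
  then show "\<exists>A. countable A \<and> A \<subseteq> sets (slice \<omega>) \<and> \<Union> A = space (slice \<omega>) \<and>
      (\<forall>a\<in>A. emeasure (slice \<omega>) a \<noteq> \<infinity>)"
    using emeasure_slice_cball_finite[OF assms] by (intro exI[of _ ?A]) (auto simp: less_top)
qed

lemma integrable_slice:
  fixes G :: "'a::euclidean_space \<Rightarrow> real"
  assumes \<omega>: "norm \<omega> = 1" and G: "continuous_on UNIV G" and supp: "\<And>y. r < norm y \<Longrightarrow> G y = 0"
  shows "integrable (slice \<omega>) G"
proof -
  have [measurable]: "G \<in> borel_measurable borel"
    using G by (rule borel_measurable_continuous_onI)
  have "compact (G ` cball 0 r)"
    using continuous_on_subset[OF G] by (intro compact_continuous_image) auto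
  then have "bounded (G ` cball 0 r)"
    by (rule compact_imp_bounded)
  then obtain C where "\<forall>z\<in>G ` cball 0 r. norm z \<le> C"
    unfolding bounded_iff by blast
  then have C: "\<bar>G y\<bar> \<le> C" if "norm y \<le> r" for y
    using that by simp
  show ?thesis
  proof (rule Bochner_Integration.integrable_bound)
    show "integrable (slice \<omega>) (\<lambda>y. indicator (cball 0 r) y * C)"
      using emeasure_slice_cball_finite[OF \<omega>, of r]
      by (intro integrable_mult_left integrable_real_indicator) simp_all
    show "AE y in slice \<omega>. norm (G y) \<le> norm (indicator (cball 0 r) y * C)"
    proof (rule AE_I2)
      fix y
      show "norm (G y) \<le> norm (indicator (cball 0 r) y * C)"
        using C[of y] supp[of y] by (cases "norm y \<le> r") auto
    qed
  qed simp
qed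

lemma lborel_eq_distr_slice:
  fixes \<omega> :: "'a::euclidean_space"
  assumes \<omega>: "norm \<omega> = 1"
  shows "lborel = distr (slice \<omega> \<Otimes>\<^sub>M lborel) borel (\<lambda>(y, p). y + p *\<^sub>R \<omega>)"
proof (rule measure_eqI)
  fix A :: "'a set" assume "A \<in> sets lborel"
  then have [measurable]: "A \<in> sets borel"
    by simp
  interpret S: sigma_finite_measure "slice \<omega>"
    by (rule sigma_finite_slice[OF \<omega>])
  interpret P: pair_sigma_finite "slice \<omega>" "lborel :: real measure" ..
  have "emeasure lborel A = (\<integral>\<^sup>+x. indicator A x \<partial>lborel)"
    by simp
  also have "\<dots> = (\<integral>\<^sup>+p. \<integral>\<^sup>+y. indicator A (y + p *\<^sub>R \<omega>) \<partial>slice \<omega> \<partial>lborel)"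
    by (rule nn_integral_lborel_slice) (use \<omega> in auto)
  also have "\<dots> = (\<integral>\<^sup>+z. indicator A (fst z + snd z *\<^sub>R \<omega>) \<partial>(slice \<omega> \<Otimes>\<^sub>M lborel))"
    by (subst P.nn_integral_snd[symmetric]) auto
  also have "\<dots> = (\<integral>\<^sup>+x. indicator A x \<partial>distr (slice \<omega> \<Otimes>\<^sub>M lborel) borel (\<lambda>(y, p). y + p *\<^sub>R \<omega>))"
    by (subst nn_integral_distr) (auto simp: case_prod_beta)
  finally show "emeasure lborel A = emeasure (distr (slice \<omega> \<Otimes>\<^sub>M lborel) borel (\<lambda>(y, p). y + p *\<^sub>R \<omega>)) A"
    by simp
qed simp

lemma integral_lborel_slice:
  fixes F :: "'a::euclidean_space \<Rightarrow> real"
  assumes \<omega>: "norm \<omega> = 1" and F: "integrable lborel F"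
  shows "(\<integral>x. F x \<partial>lborel) = (\<integral>p. \<integral>y. F (y + p *\<^sub>R \<omega>) \<partial>slice \<omega> \<partial>lborel)"
proof -
  interpret S: sigma_finite_measure "slice \<omega>"
    by (rule sigma_finite_slice[OF \<omega>])
  interpret P: pair_sigma_finite "slice \<omega>" "lborel :: real measure" ..
  have F_meas [measurable]: "F \<in> borel_measurable borel"
    using F by auto
  have "integrable (distr (slice \<omega> \<Otimes>\<^sub>M lborel) borel (\<lambda>(y, p). y + p *\<^sub>R \<omega>)) F"
    using F lborel_eq_distr_slice[OF \<omega>] by simp
  then have int: "integrable (slice \<omega> \<Otimes>\<^sub>M lborel) (\<lambda>(y, p). F (y + p *\<^sub>R \<omega>))"
    by (subst (asm) integrable_distr_eq) (simp_all add: case_prod_beta')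
  have "(\<integral>x. F x \<partial>lborel) = (\<integral>x. F x \<partial>distr (slice \<omega> \<Otimes>\<^sub>M lborel) borel (\<lambda>(y, p). y + p *\<^sub>R \<omega>))"
    using lborel_eq_distr_slice[OF \<omega>] by simp
  also have "\<dots> = (\<integral>z. F (fst z + snd z *\<^sub>R \<omega>) \<partial>(slice \<omega> \<Otimes>\<^sub>M lborel))"
    by (subst integral_distr) (auto simp: case_prod_beta)
  also have "\<dots> = (\<integral>p. \<integral>y. F (y + p *\<^sub>R \<omega>) \<partial>slice \<omega> \<partial>lborel)"
    using P.integral_snd[OF int] by (simp add: case_prod_beta')
  finally show ?thesis .
qed

section \<open>Averaging over rays in a hyperplane\<close>

text \<open>
  Rays in a hyperplane are parametrised by their direction vectors \<open>\<eta>\<close> in a shell rather than on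
  a sphere, so that only Lebesgue measure on the hyperplane is needed.
\<close>

definition radial_shell :: "real \<Rightarrow> ('a::euclidean_space \<times> real) set" where
  "radial_shell T = {\<eta>. 1 \<le> norm \<eta> \<and> norm \<eta> \<le> 2} \<times> {0..T}"

lemma radial_shell_sets [measurable]:
  "radial_shell T \<in> sets (borel \<Otimes>\<^sub>M borel :: ('a::euclidean_space \<times> real) measure)"
  unfolding radial_shell_def by measurable

text \<open>
  This replaces polar coordinates: integrating \<open>t\<^bsup>n-2\<^esup> G (t \<eta>)\<close> over \<open>t\<close> and over
  \<open>1 \<le> norm \<eta> \<le> 2\<close> counts each point \<open>y\<close> of the hyperplane with weight \<open>dt / t\<close> on
  \<open>norm y / 2 \<le> t \<le> norm y\<close>, that is, with the constant weight \<open>ln 2\<close>.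
\<close>

lemma nn_integral_slice_radial:
  fixes G :: "'a::euclidean_space \<Rightarrow> ennreal"
  assumes \<omega>: "norm \<omega> = 1" and dim: "DIM('a) \<ge> 2" and [measurable]: "G \<in> borel_measurable borel"
    and G0: "G 0 = 0" and supp: "\<And>y. T < norm y \<Longrightarrow> G y = 0"
  shows "(\<integral>\<^sup>+z. indicator (radial_shell T) z *
            (ennreal (snd z ^ (DIM('a) - 2)) * G (snd z *\<^sub>R fst z)) \<partial>(slice \<omega> \<Otimes>\<^sub>M lborel))
         = ennreal (ln 2) * (\<integral>\<^sup>+y. G y \<partial>slice \<omega>)"
proof -
  interpret S: sigma_finite_measure "slice \<omega>"
    by (rule sigma_finite_slice[OF \<omega>])
  interpret P: pair_sigma_finite "slice \<omega>" "lborel :: real measure" ..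
  let ?w = "\<lambda>t y. indicator {0<..T} t * indicator {t..2 * t} (norm y) * ennreal (1 / t)"
  have "(\<integral>\<^sup>+z. indicator (radial_shell T) z *
            (ennreal (snd z ^ (DIM('a) - 2)) * G (snd z *\<^sub>R fst z)) \<partial>(slice \<omega> \<Otimes>\<^sub>M lborel))
      = (\<integral>\<^sup>+t. \<integral>\<^sup>+\<eta>. indicator (radial_shell T) (\<eta>, t) *
            (ennreal (t ^ (DIM('a) - 2)) * G (t *\<^sub>R \<eta>)) \<partial>slice \<omega> \<partial>lborel)"
    by (subst P.nn_integral_snd[symmetric]) auto
  also have "\<dots> = (\<integral>\<^sup>+t. \<integral>\<^sup>+y. ?w t y * G y \<partial>slice \<omega> \<partial>lborel)"
  proof (rule nn_integral_cong)
    fix t :: real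
    show "(\<integral>\<^sup>+\<eta>. indicator (radial_shell T) (\<eta>, t) *
            (ennreal (t ^ (DIM('a) - 2)) * G (t *\<^sub>R \<eta>)) \<partial>slice \<omega>)
        = (\<integral>\<^sup>+y. ?w t y * G y \<partial>slice \<omega>)"
    proof (cases "0 < t \<and> t \<le> T")
      case True
      then have t: "t > 0" "t \<le> T"
        by auto
      have pow: "t ^ (DIM('a) - 2) = (1 / t) * t ^ (DIM('a) - 1)"
        using t dim by (metis (no_types, lifting) Suc_1 Suc_diff_le diff_Suc_Suc less_irrefl
            nonzero_mult_div_cancel_left power_Suc times_divide_eq_left mult_1)
      have pow_ennreal: "ennreal (t ^ (DIM('a) - 2)) = ennreal (1 / t) * ennreal (t ^ (DIM('a) - 1))"
        unfolding pow using t by (intro ennreal_mult) auto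
      have "(\<integral>\<^sup>+\<eta>. indicator (radial_shell T) (\<eta>, t) *
            (ennreal (t ^ (DIM('a) - 2)) * G (t *\<^sub>R \<eta>)) \<partial>slice \<omega>)
          = (\<integral>\<^sup>+\<eta>. ennreal (t ^ (DIM('a) - 2)) *
              (indicator {t..2 * t} (norm (t *\<^sub>R \<eta>)) * G (t *\<^sub>R \<eta>)) \<partial>slice \<omega>)"
        using t by (intro nn_integral_cong) (auto simp: radial_shell_def split: split_indicator)
      also have "\<dots> = ennreal (t ^ (DIM('a) - 2)) *
          (\<integral>\<^sup>+\<eta>. indicator {t..2 * t} (norm (t *\<^sub>R \<eta>)) * G (t *\<^sub>R \<eta>) \<partial>slice \<omega>)"
        by (rule nn_integral_cmult) measurable
      also have "\<dots> = ennreal (1 / t) * (ennreal (t ^ (DIM('a) - 1)) *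
          (\<integral>\<^sup>+\<eta>. indicator {t..2 * t} (norm (t *\<^sub>R \<eta>)) * G (t *\<^sub>R \<eta>) \<partial>slice \<omega>))"
        by (simp only: pow_ennreal mult.assoc)
      also have "\<dots> = ennreal (1 / t) * (\<integral>\<^sup>+y. indicator {t..2 * t} (norm y) * G y \<partial>slice \<omega>)"
        by (subst nn_integral_slice_dilate[OF _ \<omega> t(1), of "\<lambda>y. indicator {t..2 * t} (norm y) * G y"]) auto
      also have "\<dots> = (\<integral>\<^sup>+y. ?w t y * G y \<partial>slice \<omega>)"
        using t by (subst nn_integral_cmult[symmetric]) (auto simp: ac_simps intro!: nn_integral_cong)
      finally show ?thesis .
    next
      case False
      then have "indicator (radial_shell T) (\<eta>, t) * (ennreal (t ^ (DIM('a) - 2)) * G (t *\<^sub>R \<eta>)) = 0" for \<eta>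
        using G0 by (cases "t = 0") (auto simp: radial_shell_def)
      moreover have "?w t y * G y = 0" for y
        using False by auto
      ultimately show ?thesis
        by (simp only: nn_integral_0_iff_AE nn_integral_const mult_zero_left)
    qed
  qed
  also have "\<dots> = (\<integral>\<^sup>+y. \<integral>\<^sup>+t. ?w t y * G y \<partial>lborel \<partial>slice \<omega>)"
    by (rule P.Fubini') (simp add: indicator_def)
  also have "\<dots> = (\<integral>\<^sup>+y. ennreal (ln 2) * G y \<partial>slice \<omega>)"
  proof (rule nn_integral_cong)
    fix y :: 'a
    show "(\<integral>\<^sup>+t. ?w t y * G y \<partial>lborel) = ennreal (ln 2) * G y"
    proof (cases "y = 0 \<or> T < norm y")
      case True
      then show ?thesis
        using G0 supp by auto
    next
      case False
      then have y: "0 < norm y" "norm y \<le> T"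
        by auto
      have "(\<integral>\<^sup>+t. ?w t y \<partial>lborel) = (\<integral>\<^sup>+t. ennreal (1 / t) * indicator {norm y / 2..norm y} t \<partial>lborel)"
        using y by (intro nn_integral_cong) (auto split: split_indicator)
      also have "\<dots> = ennreal (ln (norm y) - ln (norm y / 2))"
        using y by (intro nn_integral_FTC_Icc) (auto intro!: derivative_eq_intros simp del: zero_less_norm_iff)
      also have "ln (norm y) - ln (norm y / 2) = ln 2"
        using y by (simp add: ln_div)
      finally show ?thesis
        by (subst nn_integral_multc) (auto simp: indicator_def[of "{_.._}"])
    qed
  qed
  also have "\<dots> = ennreal (ln 2) * (\<integral>\<^sup>+y. G y \<partial>slice \<omega>)"
    by (rule nn_integral_cmult) measurable
  finally show ?thesis .
qed

lemma integral_slice_radial: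
  fixes G :: "'a::euclidean_space \<Rightarrow> real"
  assumes \<omega>: "norm \<omega> = 1" and dim: "DIM('a) \<ge> 2" and G: "integrable (slice \<omega>) G"
    and G0: "G 0 = 0" and supp: "\<And>y. T < norm y \<Longrightarrow> G y = 0"
  shows "(\<integral>z. indicator (radial_shell T) z *
            (snd z ^ (DIM('a) - 2) * G (snd z *\<^sub>R fst z)) \<partial>(slice \<omega> \<Otimes>\<^sub>M lborel))
         = ln 2 * (\<integral>y. G y \<partial>slice \<omega>)"
proof -
  let ?N = "slice \<omega> \<Otimes>\<^sub>M (lborel :: real measure)"
  let ?F = "\<lambda>z. indicator (radial_shell T) z * (snd z ^ (DIM('a) - 2) * G (snd z *\<^sub>R fst z))"
  have G_meas [measurable]: "G \<in> borel_measurable borel"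
    using G by (simp cong: measurable_cong_sets)
  have pos: "(\<integral>\<^sup>+z. ennreal (indicator (radial_shell T) z *
            (snd z ^ (DIM('a) - 2) * g (snd z *\<^sub>R fst z))) \<partial>?N)
      = ennreal (ln 2) * (\<integral>\<^sup>+y. ennreal (g y) \<partial>slice \<omega>)"
    if [measurable]: "g \<in> borel_measurable borel" and "g 0 = 0" and "\<And>y. T < norm y \<Longrightarrow> g y = 0"
    for g :: "'a \<Rightarrow> real"
  proof -
    have "(\<integral>\<^sup>+z. ennreal (indicator (radial_shell T) z *
            (snd z ^ (DIM('a) - 2) * g (snd z *\<^sub>R fst z))) \<partial>?N)
      = (\<integral>\<^sup>+z. indicator (radial_shell T) z *
            (ennreal (snd z ^ (DIM('a) - 2)) * ennreal (g (snd z *\<^sub>R fst z))) \<partial>?N)"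
      by (intro nn_integral_cong)
        (auto simp: radial_shell_def ennreal_mult' split: split_indicator)
    also have "\<dots> = ennreal (ln 2) * (\<integral>\<^sup>+y. ennreal (g y) \<partial>slice \<omega>)"
      by (rule nn_integral_slice_radial[OF \<omega> dim]) (use that in auto)
    finally show ?thesis .
  qed
  have int: "integrable ?N ?F"
  proof (rule integrableI_bounded)
    have "(\<integral>\<^sup>+z. ennreal (norm (?F z)) \<partial>?N) = (\<integral>\<^sup>+z. ennreal (indicator (radial_shell T) z *
            (snd z ^ (DIM('a) - 2) * \<bar>G (snd z *\<^sub>R fst z)\<bar>)) \<partial>?N)"
      by (intro nn_integral_cong) (auto simp: radial_shell_def abs_mult split: split_indicator)
    also have "\<dots> = ennreal (ln 2) * (\<integral>\<^sup>+y. ennreal \<bar>G y\<bar> \<partial>slice \<omega>)"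
      by (rule pos) (use G0 supp in auto)
    also have "\<dots> < \<infinity>"
      using G by (simp add: integrable_iff_bounded ennreal_mult_less_top)
    finally show "(\<integral>\<^sup>+z. ennreal (norm (?F z)) \<partial>?N) < \<infinity>" .
  qed measurable
  have "(\<integral>\<^sup>+z. ennreal (?F z) \<partial>?N) = ennreal (ln 2) * (\<integral>\<^sup>+y. ennreal (G y) \<partial>slice \<omega>)"
    by (rule pos) (use G0 supp in auto)
  moreover have "(\<integral>\<^sup>+z. ennreal (- ?F z) \<partial>?N) = ennreal (ln 2) * (\<integral>\<^sup>+y. ennreal (- G y) \<partial>slice \<omega>)"
    using pos[of "\<lambda>y. - G y"] G0 supp by simp
  ultimately show ?thesis
    using int G by (simp add: real_lebesgue_integral_def enn2real_mult algebra_simps)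
qed

text \<open>
  \<open>H m\<close> plays the role of the \<open>m\<close>-th derivative of \<open>H 0\<close> in direction \<open>\<omega>\<close>, so
  that iterating differentiation under the integral needs no further reference to smoothness.
\<close>

definition derivative_tower ::
  "'a::real_normed_vector \<Rightarrow> 'a set \<Rightarrow> (nat \<Rightarrow> 'a \<Rightarrow> 'b::real_normed_vector) \<Rightarrow> bool" where
  "derivative_tower \<omega> K H \<longleftrightarrow>
     (\<forall>m. continuous_on UNIV (H m) \<and> (\<forall>x. x \<notin> K \<longrightarrow> H m x = 0) \<and>
        (\<forall>x s. ((\<lambda>s. H m (x + s *\<^sub>R \<omega>)) has_vector_derivative H (Suc m) (x + s *\<^sub>R \<omega>)) (at s)))"

lemma continuous_compact_support_bounded:
  fixes h :: "'a::euclidean_space \<Rightarrow> 'b::real_normed_vector"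
  assumes "continuous_on UNIV h" "compact K" "\<And>x. x \<notin> K \<Longrightarrow> h x = 0"
  obtains C where "0 \<le> C" "\<And>x. norm (h x) \<le> C"
proof -
  have "bounded (h ` K)"
    using assms by (intro compact_imp_bounded compact_continuous_image) (auto intro: continuous_on_subset)
  then obtain C where "\<forall>z\<in>h ` K. norm z \<le> C"
    unfolding bounded_iff by blast
  then have "norm (h x) \<le> max C 0" for x
    using assms(3)[of x] by (cases "x \<in> K") (auto intro: max.coboundedI1)
  then show thesis
    by (intro that[of "max C 0"]) auto
qed

lemma radial_shell_finite:
  assumes \<omega>: "norm \<omega> = 1"
  shows "emeasure (slice \<omega> \<Otimes>\<^sub>M lborel) (radial_shell T) < \<infinity>"
proof -
  have "emeasure (slice \<omega> \<Otimes>\<^sub>M lborel) (radial_shell T)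
      = emeasure (slice \<omega>) {\<eta>. 1 \<le> norm \<eta> \<and> norm \<eta> \<le> 2} * emeasure lborel {0..T}"
    unfolding radial_shell_def by (rule lborel.emeasure_pair_measure_Times) measurable
  moreover have "emeasure (slice \<omega>) {\<eta>. 1 \<le> norm \<eta> \<and> norm \<eta> \<le> 2} \<le> emeasure (slice \<omega>) (cball 0 2)"
    by (intro emeasure_mono) auto
  moreover have "emeasure (slice \<omega>) (cball 0 2) < \<infinity>"
    by (rule emeasure_slice_cball_finite[OF \<omega>])
  moreover have "emeasure lborel {0..T} < \<infinity>"
    by (rule emeasure_bounded_finite) simp
  ultimately show ?thesis
    by (auto simp: ennreal_mult_less_top)
qed


text \<open>
  Tilting the rays \<open>\<eta>\<close> out of the hyperplane to \<open>\<eta> + s *\<^sub>R \<omega>\<close> and differentiating in \<open>s\<close>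
  produces one factor \<open>t\<close> and one derivative in direction \<open>\<omega>\<close>: this is how integrals over rays
  acquire the powers of \<open>t\<close> that polar coordinates ask for.
\<close>

lemma has_real_derivative_shell_integral:
  fixes H :: "nat \<Rightarrow> 'a::euclidean_space \<Rightarrow> 'a" and q :: "'a \<Rightarrow> real"
    and a w :: 'a and T :: real
  assumes \<omega>: "norm \<omega> = 1" and tower: "derivative_tower \<omega> K H" and K: "compact K"
    and q: "continuous_on UNIV q"
  defines "J m s \<equiv> \<integral>z. indicator (radial_shell T) z *
      (q (fst z) * snd z ^ m * (H m (a + snd z *\<^sub>R (fst z + s *\<^sub>R \<omega>)) \<bullet> w)) \<partial>(slice \<omega> \<Otimes>\<^sub>M lborel)"
  shows "integrable (slice \<omega> \<Otimes>\<^sub>M lborel) (\<lambda>z. indicator (radial_shell T) z *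
      (q (fst z) * snd z ^ m * (H m (a + snd z *\<^sub>R (fst z + s *\<^sub>R \<omega>)) \<bullet> w)))" (is "?int m s")
    and "(J m has_real_derivative J (Suc m) s) (at s)"
proof -
  let ?N = "slice \<omega> \<Otimes>\<^sub>M (lborel :: real measure)"
  let ?F = "\<lambda>m s z. indicator (radial_shell T) z *
      (q (fst z) * snd z ^ m * (H m (a + snd z *\<^sub>R (fst z + s *\<^sub>R \<omega>)) \<bullet> w))"
  have cont: "continuous_on UNIV (H m)" and supp: "\<And>x. x \<notin> K \<Longrightarrow> H m x = 0"
    and step: "\<And>x s. ((\<lambda>s. H m (x + s *\<^sub>R \<omega>)) has_vector_derivative H (Suc m) (x + s *\<^sub>R \<omega>)) (at s)"
    for m
    using tower by (auto simp: derivative_tower_def)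
  have [measurable]: "q \<in> borel_measurable borel" "H m \<in> borel_measurable borel" for m
    using q cont by (auto intro: borel_measurable_continuous_onI)
  have meas: "?F m s \<in> borel_measurable ?N" for m s
    by measurable
  have bound: "\<exists>C. \<forall>s z. \<bar>?F m s z\<bar> \<le> indicator (radial_shell T) z * C" for m
  proof -
    obtain C where C: "0 \<le> C" "\<And>x. norm (H m x) \<le> C"
      using continuous_compact_support_bounded[OF cont K supp] by metis
    have "bounded (q ` cball 0 2)"
      using continuous_on_subset[OF q] by (intro compact_imp_bounded compact_continuous_image) auto
    then obtain Q where "\<forall>z\<in>q ` cball 0 2. norm z \<le> Q"
      unfolding bounded_iff by blast
    then have Q: "\<bar>q \<eta>\<bar> \<le> Q" if "norm \<eta> \<le> 2" for \<eta>
      using that by simp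
    have "0 \<le> Q"
      using Q[of 0] by simp
    have "\<bar>?F m s z\<bar> \<le> indicator (radial_shell T) z * (Q * T ^ m * (C * norm w))" for s z
    proof (cases "z \<in> radial_shell T")
      case True
      then have z: "norm (fst z) \<le> 2" "0 \<le> snd z" "snd z \<le> T"
        by (auto simp: radial_shell_def)
      have "\<bar>H m x \<bullet> w\<bar> \<le> C * norm w" for x
        by (meson Cauchy_Schwarz_ineq2 C(2) mult_right_mono norm_ge_zero order_trans)
      then show ?thesis
        using True z Q \<open>0 \<le> Q\<close> by (simp add: abs_mult) (intro mult_mono power_mono; simp)
    qed simp
    then show ?thesis
      by blast
  qed
  have shell: "integrable ?N (\<lambda>z. indicator (radial_shell T) z * C)" for C :: real
    using radial_shell_finite[OF \<omega>, of T]
    by (intro integrable_mult_left integrable_real_indicator) auto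
  have int: "?int m s" for m s
  proof -
    from bound obtain C where C: "\<And>s z. \<bar>?F m s z\<bar> \<le> indicator (radial_shell T) z * C"
      by blast
    show ?thesis
      by (rule Bochner_Integration.integrable_bound[OF shell[of C] meas])
        (intro AE_I2, use C in \<open>force intro: order_trans[OF _ abs_ge_self]\<close>)
  qed
  then show "?int m s" .
  from bound obtain C where C: "\<And>s z. \<bar>?F (Suc m) s z\<bar> \<le> indicator (radial_shell T) z * C"
    by blast
  show "(J m has_real_derivative J (Suc m) s) (at s)"
    unfolding J_def
  proof (rule has_real_derivative_integral[OF int meas _ C shell])
    fix s and z :: "'a \<times> real"
    obtain \<eta> t where z: "z = (\<eta>, t)"
      by (cases z)
    have "((\<lambda>s. H m ((a + t *\<^sub>R \<eta>) + (t * s) *\<^sub>R \<omega>)) has_vector_derivative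
        t *\<^sub>R H (Suc m) ((a + t *\<^sub>R \<eta>) + (t * s) *\<^sub>R \<omega>)) (at s)"
    proof -
      have "((\<lambda>s. t * s) has_vector_derivative t) (at s)"
        by (auto intro!: derivative_eq_intros)
      from vector_diff_chain_at[OF this step] show ?thesis
        by (simp add: comp_def)
    qed
    then have "((\<lambda>s. H m (a + t *\<^sub>R (\<eta> + s *\<^sub>R \<omega>)) \<bullet> w) has_vector_derivative
        (t *\<^sub>R H (Suc m) (a + t *\<^sub>R (\<eta> + s *\<^sub>R \<omega>))) \<bullet> w) (at s)"
      using bounded_linear.has_vector_derivative[OF bounded_linear_inner_left]
      by (fastforce simp: algebra_simps)
    then have "((\<lambda>s. H m (a + t *\<^sub>R (\<eta> + s *\<^sub>R \<omega>)) \<bullet> w) has_real_derivative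
        t * (H (Suc m) (a + t *\<^sub>R (\<eta> + s *\<^sub>R \<omega>)) \<bullet> w)) (at s)"
      by (simp add: has_real_derivative_iff_has_vector_derivative)
    from DERIV_cmult[OF this, of "indicator (radial_shell T) z * (q \<eta> * t ^ m)"]
    show "((\<lambda>s. ?F m s z) has_real_derivative ?F (Suc m) s z) (at s)"
      by (simp add: z mult_ac)
  qed
qed

section \<open>From ray integrals to hyperplane integrals\<close>

text \<open>
  The ray integrals \<open>X \<xi>\<close> from \<open>a\<close> being parallel to \<open>\<xi>\<close> means
  \<open>(\<xi> \<bullet> v) * (X \<xi> \<bullet> \<omega>) = (\<xi> \<bullet> \<omega>) * (X \<xi> \<bullet> v)\<close>. For \<open>\<xi> = \<eta> + s *\<^sub>R \<omega>\<close> with \<open>\<eta>\<close> and \<open>v\<close>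
  orthogonal to \<open>\<omega>\<close> the scalar factors are \<open>\<eta> \<bullet> v\<close> and \<open>s\<close>, so the averages over \<open>\<eta>\<close> satisfy
  \<open>J 0 s = s * L 0 s\<close>. Differentiating \<open>n - 1\<close> times at \<open>s = 0\<close> leaves
  \<open>(n - 1) * L (n - 2) 0\<close> on the right, and both sides are radial averages, hence integrals over
  the hyperplane through \<open>a\<close>.
\<close>

lemma slice_identity:
  fixes H :: "nat \<Rightarrow> 'a::euclidean_space \<Rightarrow> 'a"
  assumes \<omega>: "norm \<omega> = 1" and dim: "DIM('a) \<ge> 2" and tower: "derivative_tower \<omega> K H"
    and K: "compact K" "K \<subseteq> cball a T" "a \<notin> K" and v: "\<omega> \<bullet> v = 0"
    and ray: "\<And>\<xi>. 1 \<le> norm \<xi> \<Longrightarrow>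
      \<exists>c. (\<integral>t. indicator {0..T} t *\<^sub>R H 0 (a + t *\<^sub>R \<xi>) \<partial>lborel) = c *\<^sub>R \<xi>"
  shows "(\<integral>y. (y \<bullet> v) * (H (DIM('a) - 1) (a + y) \<bullet> \<omega>) \<partial>slice \<omega>)
    = real (DIM('a) - 1) * (\<integral>y. H (DIM('a) - 2) (a + y) \<bullet> v \<partial>slice \<omega>)"
proof -
  let ?N = "slice \<omega> \<Otimes>\<^sub>M (lborel :: real measure)"
  let ?F = "\<lambda>q w m s z. indicator (radial_shell T) z *
      (q (fst z) * snd z ^ m * (H m (a + snd z *\<^sub>R (fst z + s *\<^sub>R \<omega>)) \<bullet> w))"
  interpret S: sigma_finite_measure "slice \<omega>"
    by (rule sigma_finite_slice[OF \<omega>])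
  interpret P: pair_sigma_finite "slice \<omega>" "lborel :: real measure" ..
  have cont: "continuous_on UNIV (H m)" and supp: "\<And>x. x \<notin> K \<Longrightarrow> H m x = 0" for m
    using tower by (auto simp: derivative_tower_def)
  have [measurable]: "H m \<in> borel_measurable borel" for m
    using cont by (auto intro: borel_measurable_continuous_onI)
  define J where "J m s = (\<integral>z. ?F (\<lambda>\<eta>. \<eta> \<bullet> v) \<omega> m s z \<partial>?N)" for m s
  define L where "L m s = (\<integral>z. ?F (\<lambda>\<eta>. 1) v m s z \<partial>?N)" for m s
  have q: "continuous_on UNIV (\<lambda>\<eta>. \<eta> \<bullet> v)" "continuous_on UNIV (\<lambda>\<eta>::'a. 1 :: real)"
    by (auto intro: continuous_intros)
  have intJ: "integrable ?N (?F (\<lambda>\<eta>. \<eta> \<bullet> v) \<omega> m s)" and intL: "integrable ?N (?F (\<lambda>\<eta>. 1) v m s)"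
    for m s
    by (rule has_real_derivative_shell_integral(1)[OF \<omega> tower K(1) q(1)]
        has_real_derivative_shell_integral(1)[OF \<omega> tower K(1) q(2)])+
  have derivJ: "(J m has_real_derivative J (Suc m) s) (at s)"
    and derivL: "(L m has_real_derivative L (Suc m) s) (at s)" for m s
    unfolding J_def L_def
    by (rule has_real_derivative_shell_integral(2)[OF \<omega> tower K(1) q(1)]
        has_real_derivative_shell_integral(2)[OF \<omega> tower K(1) q(2)])+
  have J0: "J 0 s = s * L 0 s" for s
  proof -
    have "J 0 s = (\<integral>\<eta>. \<integral>t. ?F (\<lambda>\<eta>. \<eta> \<bullet> v) \<omega> 0 s (\<eta>, t) \<partial>lborel \<partial>slice \<omega>)"
      unfolding J_def using P.integral_fst'[OF intJ, of 0 s] by simp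
    also have "\<dots> = (\<integral>\<eta>. s * (\<integral>t. ?F (\<lambda>\<eta>. 1) v 0 s (\<eta>, t) \<partial>lborel) \<partial>slice \<omega>)"
    proof (rule integral_cong_AE)
      show "AE \<eta> in slice \<omega>. (\<integral>t. ?F (\<lambda>\<eta>. \<eta> \<bullet> v) \<omega> 0 s (\<eta>, t) \<partial>lborel)
          = s * (\<integral>t. ?F (\<lambda>\<eta>. 1) v 0 s (\<eta>, t) \<partial>lborel)"
        using AE_slice_orthogonal[OF \<omega>]
      proof eventually_elim
        case (elim \<eta>)
        let ?i = "indicator {\<eta>. 1 \<le> norm \<eta> \<and> norm \<eta> \<le> 2} \<eta> :: real"
        define \<xi> where "\<xi> = \<eta> + s *\<^sub>R \<omega>"
        define I where "I w = (\<integral>t. indicator {0..T} t * (H 0 (a + t *\<^sub>R \<xi>) \<bullet> w) \<partial>lborel)" for w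
        have I: "(\<integral>t. ?F q w 0 s (\<eta>, t) \<partial>lborel) = ?i * q \<eta> * I w" for q w
        proof -
          have "(\<integral>t. ?F q w 0 s (\<eta>, t) \<partial>lborel)
              = (\<integral>t. (?i * q \<eta>) * (indicator {0..T} t * (H 0 (a + t *\<^sub>R \<xi>) \<bullet> w)) \<partial>lborel)"
            by (intro Bochner_Integration.integral_cong)
              (auto simp: radial_shell_def \<xi>_def indicator_def)
          then show ?thesis
            by (simp add: I_def)
        qed
        have inner: "\<xi> \<bullet> \<omega> = s" "\<xi> \<bullet> v = \<eta> \<bullet> v"
          using elim \<omega> v inner_commute[of \<eta> \<omega>] by (simp_all add: \<xi>_def inner_add_left dot_square_norm)
        have "(\<eta> \<bullet> v) * I \<omega> = s * I v" if "1 \<le> norm \<eta>"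
        proof -
          have "(norm \<xi>)\<^sup>2 = (norm \<eta>)\<^sup>2 + s\<^sup>2"
            using norm_add_Pythagorean[of \<eta> "s *\<^sub>R \<omega>"] elim \<omega>
            by (simp add: \<xi>_def orthogonal_def inner_commute)
          then have "(norm \<eta>)\<^sup>2 \<le> (norm \<xi>)\<^sup>2"
            by simp
          then have "1 \<le> norm \<xi>"
            using that by (meson norm_ge_zero order_trans power2_le_imp_le)
          then obtain c where c: "(\<integral>t. indicator {0..T} t *\<^sub>R H 0 (a + t *\<^sub>R \<xi>) \<partial>lborel) = c *\<^sub>R \<xi>"
            using ray by blast
          have "set_integrable lborel {0..T} (\<lambda>t. H 0 (a + t *\<^sub>R \<xi>))"
            by (intro borel_integrable_atLeastAtMost' continuous_on_compose2[OF cont])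
              (auto intro!: continuous_intros)
          then have "I w = c * (\<xi> \<bullet> w)" for w
            using integral_inner_left[of w lborel "\<lambda>t. indicator {0..T} t *\<^sub>R H 0 (a + t *\<^sub>R \<xi>)"] c
            by (simp add: I_def set_integrable_def)
          then show ?thesis
            by (simp add: inner)
        qed
        then show ?case
          using I[of "\<lambda>\<eta>. \<eta> \<bullet> v" \<omega>] I[of "\<lambda>_. 1" v]
          by (cases "1 \<le> norm \<eta> \<and> norm \<eta> \<le> 2") (simp_all add: mult_ac)
      qed
    qed measurable
    also have "\<dots> = s * L 0 s"
      unfolding L_def using P.integral_fst'[OF intL, of 0 s] by simp
    finally show ?thesis .
  qed
  \<comment> \<open>Leibniz rule; for \<open>m = 0\<close> the truncated index \<open>m - 1\<close> is multiplied by \<open>0\<close>.\<close>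
  have J: "J m s = s * L m s + real m * L (m - 1) s" for m s
  proof (induction m arbitrary: s)
    case 0
    then show ?case
      by (simp add: J0)
  next
    case (Suc m)
    have eq: "J m = (\<lambda>s. s * L m s + real m * L (m - 1) s)"
      using Suc.IH by blast
    have "((\<lambda>s. s * L m s + real m * L (m - 1) s) has_real_derivative
        L m s + s * L (Suc m) s + real m * L (Suc (m - 1)) s) (at s)"
      using derivL by (auto intro!: derivative_eq_intros)
    moreover have "real m * L (Suc (m - 1)) s = real m * L m s"
      by (cases m) auto
    ultimately show ?case
      using DERIV_unique[OF derivJ[of m s]] by (fastforce simp: eq algebra_simps)
  qed
  have radial: "(\<integral>z. indicator (radial_shell T) z *
            (snd z ^ (DIM('a) - 2) * G (snd z *\<^sub>R fst z)) \<partial>?N) = ln 2 * (\<integral>y. G y \<partial>slice \<omega>)"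
    if G: "continuous_on UNIV G" and zero: "\<And>y. a + y \<notin> K \<Longrightarrow> G y = 0" for G :: "'a \<Rightarrow> real"
  proof -
    have far: "G y = 0" if "T < norm y" for y
      using that K(2) by (intro zero) (auto simp: subset_iff dist_norm)
    show ?thesis
      using K(3) by (intro integral_slice_radial[OF \<omega> dim] integrable_slice[OF \<omega> G] far zero) auto
  qed
  define k where "k = DIM('a) - 2"
  have k: "DIM('a) - 1 = Suc k"
    using dim by (simp add: k_def)
  have "J (Suc k) 0 = ln 2 * (\<integral>y. (y \<bullet> v) * (H (Suc k) (a + y) \<bullet> \<omega>) \<partial>slice \<omega>)"
  proof -
    have "J (Suc k) 0 = (\<integral>z. indicator (radial_shell T) z *
        (snd z ^ k * ((snd z *\<^sub>R fst z) \<bullet> v * (H (Suc k) (a + snd z *\<^sub>R fst z) \<bullet> \<omega>))) \<partial>?N)"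
      unfolding J_def by (intro Bochner_Integration.integral_cong) (simp_all add: mult_ac)
    also have "\<dots> = ln 2 * (\<integral>y. (y \<bullet> v) * (H (Suc k) (a + y) \<bullet> \<omega>) \<partial>slice \<omega>)"
      unfolding k_def by (rule radial)
        (auto simp: supp intro!: continuous_intros continuous_on_compose2[OF cont])
    finally show ?thesis .
  qed
  moreover have "L k 0 = ln 2 * (\<integral>y. H k (a + y) \<bullet> v \<partial>slice \<omega>)"
  proof -
    have "L k 0 = (\<integral>z. indicator (radial_shell T) z *
        (snd z ^ k * (H k (a + snd z *\<^sub>R fst z) \<bullet> v)) \<partial>?N)"
      unfolding L_def by (intro Bochner_Integration.integral_cong) (simp_all add: mult_ac)
    also have "\<dots> = ln 2 * (\<integral>y. H k (a + y) \<bullet> v \<partial>slice \<omega>)"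
      unfolding k_def by (rule radial)
        (auto simp: supp intro!: continuous_intros continuous_on_compose2[OF cont])
    finally show ?thesis .
  qed
  moreover have "J (Suc k) 0 = real (Suc k) * L k 0"
    using J[of "Suc k" 0] by simp
  ultimately have "ln 2 * (\<integral>y. (y \<bullet> v) * (H (Suc k) (a + y) \<bullet> \<omega>) \<partial>slice \<omega>)
      = ln 2 * (real (Suc k) * (\<integral>y. H k (a + y) \<bullet> v \<partial>slice \<omega>))"
    by simp
  then have "(\<integral>y. (y \<bullet> v) * (H (Suc k) (a + y) \<bullet> \<omega>) \<partial>slice \<omega>)
      = real (Suc k) * (\<integral>y. H k (a + y) \<bullet> v \<partial>slice \<omega>)"
    by (subst (asm) mult_cancel_left) simp
  then show ?thesis
    by (simp only: k k_def[symmetric])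
qed

text \<open>
  The identity of a hyperplane depends on the base point \<open>a\<close> only through the factor \<open>y = x - a\<close>
  on the left. Subtracting it for two base points in the same hyperplane, with the direction
  \<open>v = a - a'\<close>, isolates the integral of \<open>H m \<bullet> \<omega>\<close>, which therefore vanishes; after that the
  base point disappears from the identity.
\<close>

lemma two_point_elimination:
  fixes H :: "nat \<Rightarrow> 'a::euclidean_space \<Rightarrow> 'a"
  assumes \<omega>: "norm \<omega> = 1" and tower: "derivative_tower \<omega> K H" and K: "compact K"
    and a: "\<omega> \<bullet> a = p" "\<omega> \<bullet> a' = p" "a \<noteq> a'"
    and id: "\<And>v b. \<omega> \<bullet> v = 0 \<Longrightarrow> b \<in> {a, a'} \<Longrightarrow>
      (\<integral>y. (y \<bullet> v) * (H m (b + y) \<bullet> \<omega>) \<partial>slice \<omega>) = c * (\<integral>y. H l (b + y) \<bullet> v \<partial>slice \<omega>)"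
  shows "(\<integral>y. H m (y + p *\<^sub>R \<omega>) \<bullet> \<omega> \<partial>slice \<omega>) = 0"
    and "\<And>v. \<omega> \<bullet> v = 0 \<Longrightarrow> (\<integral>y. (y \<bullet> v) * (H m (y + p *\<^sub>R \<omega>) \<bullet> \<omega>) \<partial>slice \<omega>)
      = c * (\<integral>y. H l (y + p *\<^sub>R \<omega>) \<bullet> v \<partial>slice \<omega>)"
proof -
  have cont: "continuous_on UNIV (H m)" and supp: "\<And>x. x \<notin> K \<Longrightarrow> H m x = 0" for m
    using tower by (auto simp: derivative_tower_def)
  have [measurable]: "H m \<in> borel_measurable borel" for m
    using cont by (auto intro: borel_measurable_continuous_onI)
  obtain R where R: "K \<subseteq> cball 0 R"
    using bounded_subset_ballD[OF compact_imp_bounded[OF K], of 0] by (meson ball_subset_cball order_trans)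
  have integrable: "integrable (slice \<omega>) (\<lambda>y. q y * (H m (y + p *\<^sub>R \<omega>) \<bullet> w))"
    if "continuous_on UNIV q" for q m w
  proof (rule integrable_slice[OF \<omega>])
    show "continuous_on UNIV (\<lambda>y. q y * (H m (y + p *\<^sub>R \<omega>) \<bullet> w))"
      by (intro continuous_intros that continuous_on_compose2[OF cont]) auto
    show "q y * (H m (y + p *\<^sub>R \<omega>) \<bullet> w) = 0" if "R + \<bar>p\<bar> < norm y" for y
    proof -
      have "norm y \<le> norm (y + p *\<^sub>R \<omega>) + \<bar>p\<bar>"
        using norm_triangle_ineq4[of "y + p *\<^sub>R \<omega>" "p *\<^sub>R \<omega>"] \<omega> by simp
      then have "y + p *\<^sub>R \<omega> \<notin> K"
        using that R by (auto simp: subset_iff)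
      then show ?thesis
        by (simp add: supp)
    qed
  qed
  define A where "A = (\<integral>y. H m (y + p *\<^sub>R \<omega>) \<bullet> \<omega> \<partial>slice \<omega>)"
  define B where "B v = (\<integral>y. (y \<bullet> v) * (H m (y + p *\<^sub>R \<omega>) \<bullet> \<omega>) \<partial>slice \<omega>)" for v
  define C where "C v = (\<integral>y. H l (y + p *\<^sub>R \<omega>) \<bullet> v \<partial>slice \<omega>)" for v
  \<comment> \<open>The identity at \<open>b\<close>, translated within the hyperplane so that its base point is \<open>p *\<^sub>R \<omega>\<close>.\<close>
  have eq: "B v - (b \<bullet> v) * A = c * C v" if v: "\<omega> \<bullet> v = 0" and b: "b \<in> {a, a'}" for v b
  proof -
    define u where "u = b - p *\<^sub>R \<omega>"
    have u: "\<omega> \<bullet> u = 0" "u \<bullet> v = b \<bullet> v" "\<And>y. b + y = (y + u) + p *\<^sub>R \<omega>"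
      using a b \<omega> v by (auto simp: u_def inner_diff_right inner_diff_left dot_square_norm algebra_simps)
    have "(\<integral>y. (y \<bullet> v) * (H m (b + y) \<bullet> \<omega>) \<partial>slice \<omega>)
        = (\<integral>y. (((y + u) - u) \<bullet> v) * (H m ((y + u) + p *\<^sub>R \<omega>) \<bullet> \<omega>) \<partial>slice \<omega>)"
      by (simp add: u(3))
    also have "\<dots> = (\<integral>y. ((y - u) \<bullet> v) * (H m (y + p *\<^sub>R \<omega>) \<bullet> \<omega>) \<partial>slice \<omega>)"
      by (rule integral_slice_translate[OF u(1)]) measurable
    also have "\<dots> = (\<integral>y. (y \<bullet> v) * (H m (y + p *\<^sub>R \<omega>) \<bullet> \<omega>)
        - (b \<bullet> v) * (H m (y + p *\<^sub>R \<omega>) \<bullet> \<omega>) \<partial>slice \<omega>)"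
      by (simp add: inner_diff_left u(2) algebra_simps)
    also have "\<dots> = B v - (b \<bullet> v) * A"
      unfolding A_def B_def using integrable[of "\<lambda>_. 1" m \<omega>]
        integrable[OF continuous_on_inner[OF continuous_on_id continuous_on_const], of v m \<omega>]
      by (subst Bochner_Integration.integral_diff) auto
    also have "(\<integral>y. (y \<bullet> v) * (H m (b + y) \<bullet> \<omega>) \<partial>slice \<omega>)
        = c * (\<integral>y. H l ((y + u) + p *\<^sub>R \<omega>) \<bullet> v \<partial>slice \<omega>)"
      by (simp add: id[OF v b] flip: u(3))
    also have "(\<integral>y. H l ((y + u) + p *\<^sub>R \<omega>) \<bullet> v \<partial>slice \<omega>) = C v"
      unfolding C_def by (rule integral_slice_translate[OF u(1)]) measurable
    finally show ?thesis ..
  qed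
  have perp: "\<omega> \<bullet> (a - a') = 0"
    using a by (simp add: inner_diff_right)
  have "((a - a') \<bullet> (a - a')) * A = 0"
    using eq[OF perp, of a] eq[OF perp, of a'] by (simp add: inner_diff_left algebra_simps)
  then have A: "A = 0"
    using a by simp
  then show "(\<integral>y. H m (y + p *\<^sub>R \<omega>) \<bullet> \<omega> \<partial>slice \<omega>) = 0"
    by (simp add: A_def)
  show "(\<integral>y. (y \<bullet> v) * (H m (y + p *\<^sub>R \<omega>) \<bullet> \<omega>) \<partial>slice \<omega>)
      = c * (\<integral>y. H l (y + p *\<^sub>R \<omega>) \<bullet> v \<partial>slice \<omega>)" if "\<omega> \<bullet> v = 0" for v
    using eq[OF that, of a] A by (simp add: B_def C_def)
qed

section \<open>The two-sided Laplace transform of a compactly supported field\<close>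

lemma integrable_continuous_compact_support:
  fixes g :: "'a::euclidean_space \<Rightarrow> 'b::euclidean_space"
  assumes g: "continuous_on UNIV g" and K: "compact K" and supp: "\<And>x. x \<notin> K \<Longrightarrow> g x = 0"
  shows "integrable lborel g"
proof -
  have "integrable lborel (\<lambda>x. indicator K x *\<^sub>R g x)"
    using K g by (intro borel_integrable_compact) (auto intro: continuous_on_subset)
  moreover have "(\<lambda>x. indicator K x *\<^sub>R g x) = g"
    using supp by (auto simp: indicator_def)
  ultimately show ?thesis
    by simp
qed

lemma integral_lborel_translate:
  fixes g :: "'a::euclidean_space \<Rightarrow> real"
  assumes [measurable]: "g \<in> borel_measurable borel"
  shows "(\<integral>x. g (x + u) \<partial>lborel) = (\<integral>x. g x \<partial>lborel)"
proof -
  have "(\<integral>x. g x \<partial>lborel) = (\<integral>x. g x \<partial>distr lborel borel ((+) u))"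
    by (simp add: lborel_distr_plus)
  also have "\<dots> = (\<integral>x. g (x + u) \<partial>lborel)"
    by (subst integral_distr) (simp_all add: add.commute)
  finally show ?thesis ..
qed

text \<open>
  The integral of a translate does not depend on the translation; differentiate in it.
\<close>

lemma integral_directional_derivative_eq_0:
  fixes g g' :: "'a::euclidean_space \<Rightarrow> real"
  assumes \<omega>: "norm \<omega> = 1" and K: "compact K"
    and g: "continuous_on UNIV g" "\<And>x. x \<notin> K \<Longrightarrow> g x = 0"
    and g': "continuous_on UNIV g'" "\<And>x. x \<notin> K \<Longrightarrow> g' x = 0"
    and deriv: "\<And>x s. ((\<lambda>s. g (x + s *\<^sub>R \<omega>)) has_real_derivative g' (x + s *\<^sub>R \<omega>)) (at s)"
  shows "(\<integral>x. g' x \<partial>lborel) = 0"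
proof -
  obtain R where R: "K \<subseteq> cball 0 R"
    using bounded_subset_ballD[OF compact_imp_bounded[OF K], of 0] by (meson ball_subset_cball order_trans)
  obtain C where C: "0 \<le> C" "\<And>x. norm (g' x) \<le> C"
    using continuous_compact_support_bounded[OF g'(1) K g'(2)] by metis
  have meas [measurable]: "g \<in> borel_measurable borel" "g' \<in> borel_measurable borel"
    using g g' by (auto intro: borel_measurable_continuous_onI)
  have "((\<lambda>s. \<integral>x. g (x + s *\<^sub>R \<omega>) \<partial>lborel) has_real_derivative (\<integral>x. g' (x + 0 *\<^sub>R \<omega>) \<partial>lborel)) (at 0)"
  proof (rule has_real_derivative_integral[where g = "\<lambda>x. indicator (cball 0 (R + 1)) x * C"])
    show "integrable lborel (\<lambda>x. g (x + s *\<^sub>R \<omega>))" for s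
    proof (rule integrable_continuous_compact_support)
      show "compact ((\<lambda>x. x - s *\<^sub>R \<omega>) ` K)"
        by (intro compact_continuous_image K continuous_intros)
      show "g (x + s *\<^sub>R \<omega>) = 0" if "x \<notin> (\<lambda>x. x - s *\<^sub>R \<omega>) ` K" for x
        using that by (intro g) (auto simp: image_iff algebra_simps)
      show "continuous_on UNIV (\<lambda>x. g (x + s *\<^sub>R \<omega>))"
        by (intro continuous_on_compose2[OF g(1)] continuous_intros) auto
    qed
    show "\<bar>g' (x + s *\<^sub>R \<omega>)\<bar> \<le> indicator (cball 0 (R + 1)) x * C" if "\<bar>s - 0\<bar> < 1" for s x
    proof (cases "norm x \<le> R + 1")
      case True
      then show ?thesis
        using C by simp
    next
      case False
      have "norm x \<le> norm (x + s *\<^sub>R \<omega>) + \<bar>s\<bar>"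
        using norm_triangle_ineq4[of "x + s *\<^sub>R \<omega>" "s *\<^sub>R \<omega>"] \<omega> by simp
      then have "x + s *\<^sub>R \<omega> \<notin> K"
        using False that R by (auto simp: subset_iff)
      then show ?thesis
        using C by (simp add: g')
    qed
    show "integrable lborel (\<lambda>x::'a. indicator (cball 0 (R + 1)) x * C)"
      by (intro integrable_mult_left integrable_real_indicator)
        (simp_all add: emeasure_bounded_finite del: infinity_ennreal_def)
  qed (use deriv in measurable)
  moreover have "(\<lambda>s. \<integral>x. g (x + s *\<^sub>R \<omega>) \<partial>lborel) = (\<lambda>s. \<integral>x. g x \<partial>lborel)"
    by (simp add: integral_lborel_translate)
  ultimately show ?thesis
    using DERIV_unique[OF DERIV_const] by fastforce
qed

text \<open>
  Integration by parts along \<open>\<omega>\<close>; the weight \<open>q\<close> is constant in that direction.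
\<close>

lemma laplace_derivative_tower:
  fixes H :: "nat \<Rightarrow> 'a::euclidean_space \<Rightarrow> 'a"
  assumes \<omega>: "norm \<omega> = 1" and tower: "derivative_tower \<omega> K H" and K: "compact K"
    and q: "continuous_on UNIV q" "\<And>x s. q (x + s *\<^sub>R \<omega>) = q x"
  shows "(\<integral>x. q x * (H m x \<bullet> w) * exp (\<sigma> * (\<omega> \<bullet> x)) \<partial>lborel)
    = (- \<sigma>) ^ m * (\<integral>x. q x * (H 0 x \<bullet> w) * exp (\<sigma> * (\<omega> \<bullet> x)) \<partial>lborel)"
proof (induction m)
  case (Suc m)
  have cont: "continuous_on UNIV (H m)" and supp: "\<And>x. x \<notin> K \<Longrightarrow> H m x = 0"
    and step: "\<And>x s. ((\<lambda>s. H m (x + s *\<^sub>R \<omega>)) has_vector_derivative H (Suc m) (x + s *\<^sub>R \<omega>)) (at s)"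
    for m
    using tower by (auto simp: derivative_tower_def)
  let ?g = "\<lambda>m x. q x * (H m x \<bullet> w) * exp (\<sigma> * (\<omega> \<bullet> x))"
  have cont_g: "continuous_on UNIV (?g m)" for m
    by (intro continuous_intros q cont)
  have int: "integrable lborel (?g m)" for m
    by (rule integrable_continuous_compact_support[OF cont_g K]) (simp add: supp)
  have "(\<integral>x. ?g (Suc m) x + \<sigma> * ?g m x \<partial>lborel) = 0"
  proof (rule integral_directional_derivative_eq_0[OF \<omega> K cont_g])
    show "continuous_on UNIV (\<lambda>x. ?g (Suc m) x + \<sigma> * ?g m x)"
      by (intro continuous_intros q cont)
    fix x s
    have "((\<lambda>s. H m (x + s *\<^sub>R \<omega>) \<bullet> w) has_real_derivative H (Suc m) (x + s *\<^sub>R \<omega>) \<bullet> w) (at s)"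
      unfolding has_real_derivative_iff_has_vector_derivative
      by (rule bounded_linear.has_vector_derivative[OF bounded_linear_inner_left step])
    moreover have "((\<lambda>s. \<sigma> * (\<omega> \<bullet> (x + s *\<^sub>R \<omega>))) has_real_derivative \<sigma>) (at s)"
      using \<omega> by (auto simp: inner_add_right dot_square_norm intro!: derivative_eq_intros)
    moreover have "\<omega> \<bullet> \<omega> = 1"
      using \<omega> by (simp add: dot_square_norm)
    ultimately show "((\<lambda>s. ?g m (x + s *\<^sub>R \<omega>)) has_real_derivative
        ?g (Suc m) (x + s *\<^sub>R \<omega>) + \<sigma> * ?g m (x + s *\<^sub>R \<omega>)) (at s)"
      unfolding q(2) by (auto simp: algebra_simps intro!: derivative_eq_intros)
  qed (simp_all add: supp)
  then have "(\<integral>x. ?g (Suc m) x \<partial>lborel) = - \<sigma> * (\<integral>x. ?g m x \<partial>lborel)"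
    using int[of m] int[of "Suc m"] by simp
  then show ?case
    using Suc.IH by simp
qed simp

lemma AE_lborel_open:
  fixes U :: "'a::euclidean_space set"
  assumes P: "AE x in lborel. P x" and U: "open U" "U \<noteq> {}"
  shows "\<exists>x\<in>U. P x"
proof (rule ccontr)
  assume "\<not> (\<exists>x\<in>U. P x)"
  with P have "AE x in lborel. x \<notin> U"
    by (auto elim: eventually_mono)
  then have "U \<in> null_sets lborel"
    using U by (subst AE_iff_null_sets) auto
  then have "negligible U"
    by (simp add: negligible_iff_null_sets null_sets_completionI)
  then show False
    using open_not_negligible[OF U] by blast
qed

text \<open>
  For compactly supported fields the real exponentials serve the purpose of the Fourier transform:
  the transform is defined everywhere, and the exponentials span an algebra that separates points.
\<close>

definition laplace :: "('a::euclidean_space \<Rightarrow> 'a) \<Rightarrow> 'a \<Rightarrow> 'a" where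
  "laplace h k = (\<integral>x. exp (k \<bullet> x) *\<^sub>R h x \<partial>lborel)"

lemma integrable_laplace:
  fixes h :: "'a::euclidean_space \<Rightarrow> 'a"
  assumes "continuous_on UNIV h" and "compact K" and "\<And>x. x \<notin> K \<Longrightarrow> h x = 0"
  shows "integrable lborel (\<lambda>x. exp (k \<bullet> x) *\<^sub>R h x)"
  by (rule integrable_continuous_compact_support[OF _ assms(2)])
    (auto simp: assms(3) intro!: continuous_intros assms(1))

lemma inner_laplace:
  fixes h :: "'a::euclidean_space \<Rightarrow> 'a"
  assumes "continuous_on UNIV h" and "compact K" and "\<And>x. x \<notin> K \<Longrightarrow> h x = 0"
  shows "laplace h k \<bullet> w = (\<integral>x. (h x \<bullet> w) * exp (k \<bullet> x) \<partial>lborel)"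
  unfolding laplace_def
  by (subst integral_inner_left[symmetric]) (auto simp: mult.commute intro: integrable_laplace[OF assms])

lemma continuous_laplace:
  fixes h :: "'a::euclidean_space \<Rightarrow> 'a"
  assumes h: "continuous_on UNIV h" and K: "compact K" and supp: "\<And>x. x \<notin> K \<Longrightarrow> h x = 0"
  shows "continuous_on UNIV (laplace h)"
proof (rule continuous_at_imp_continuous_on, intro ballI)
  fix k
  have [measurable]: "h \<in> borel_measurable borel"
    using h by (rule borel_measurable_continuous_onI)
  obtain R where R: "K \<subseteq> cball 0 R"
    using bounded_subset_ballD[OF compact_imp_bounded[OF K], of 0] by (meson ball_subset_cball order_trans)
  show "isCont (laplace h) k"
    unfolding continuous_at_sequentially
  proof (intro allI impI)
    fix u :: "nat \<Rightarrow> 'a" assume u: "u \<longlonglongrightarrow> k"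
    then obtain B where B: "\<And>n. norm (u n) \<le> B"
      using convergent_imp_Bseq[of u] by (auto simp: convergent_def Bseq_def)
    have "(\<lambda>n. \<integral>x. exp (u n \<bullet> x) *\<^sub>R h x \<partial>lborel) \<longlonglongrightarrow> (\<integral>x. exp (k \<bullet> x) *\<^sub>R h x \<partial>lborel)"
    proof (rule integral_dominated_convergence[where w = "\<lambda>x. exp (B * R) * norm (h x)"])
      show "integrable lborel (\<lambda>x. exp (B * R) * norm (h x))"
        using integrable_laplace[OF assms, of 0] by simp
      show "AE x in lborel. (\<lambda>n. exp (u n \<bullet> x) *\<^sub>R h x) \<longlonglongrightarrow> exp (k \<bullet> x) *\<^sub>R h x"
        by (intro AE_I2 tendsto_intros u)
      show "AE x in lborel. norm (exp (u n \<bullet> x) *\<^sub>R h x) \<le> exp (B * R) * norm (h x)" for n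
      proof (intro AE_I2)
        fix x
        show "norm (exp (u n \<bullet> x) *\<^sub>R h x) \<le> exp (B * R) * norm (h x)"
        proof (cases "x \<in> K")
          case True
          have "u n \<bullet> x \<le> norm (u n) * norm x"
            by (rule norm_cauchy_schwarz)
          also have "\<dots> \<le> B * R"
            using True R B[of n] by (intro mult_mono) (auto simp: subset_iff intro: order_trans[OF norm_ge_zero])
          finally show ?thesis
            by (simp add: mult_right_mono)
        qed (simp add: supp)
      qed
    qed measurable
    then show "(laplace h \<circ> u) \<longlonglongrightarrow> laplace h k"
      by (simp add: laplace_def comp_def)
  qed
qed

text \<open>
  Call \<open>g\<close> admissible if multiplying by \<open>g\<close> preserves the vanishing of the transform of
  \<open>\<phi> *\<^sub>R h\<close>, for every continuous \<open>\<phi>\<close>. Admissible functions form an algebra by definition, and it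
  contains the exponentials, which only shift the transform. By Stone-Weierstrass each component
  of \<open>h\<close> is a uniform limit of admissible functions on \<open>K\<close>, and \<open>h\<close> is orthogonal to those.
\<close>

lemma laplace_injective:
  fixes h :: "'a::euclidean_space \<Rightarrow> 'a"
  assumes h: "continuous_on UNIV h" and K: "compact K" and supp: "\<And>x. x \<notin> K \<Longrightarrow> h x = 0"
    and zero: "\<And>k. laplace h k = 0"
  shows "h x = 0"
proof -
  define A where "A g \<longleftrightarrow> continuous_on UNIV g \<and> (\<forall>\<phi>. continuous_on UNIV \<phi> \<longrightarrow>
      (\<forall>k. (\<integral>x. exp (k \<bullet> x) *\<^sub>R \<phi> x *\<^sub>R h x \<partial>lborel) = 0) \<longrightarrow>
      (\<forall>k. (\<integral>x. exp (k \<bullet> x) *\<^sub>R (\<phi> x * g x) *\<^sub>R h x \<partial>lborel) = 0))" for g :: "'a \<Rightarrow> real"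
  have int: "integrable lborel (\<lambda>x. exp (k \<bullet> x) *\<^sub>R g x *\<^sub>R h x)" if "continuous_on UNIV g" for g k
    by (rule integrable_continuous_compact_support[OF _ K])
      (auto simp: supp intro!: continuous_intros h that)
  have approx: "\<exists>g. A g \<and> (\<forall>x\<in>K. \<bar>F x - g x\<bar> < e)" if "continuous_on UNIV F" "0 < e" for F e
  proof (rule Stone_Weierstrass_HOL[OF K])
    show "A (\<lambda>_. c)" for c
    proof -
      have "(\<integral>x. exp (k \<bullet> x) *\<^sub>R (\<phi> x * c) *\<^sub>R h x \<partial>lborel)
          = c *\<^sub>R (\<integral>x. exp (k \<bullet> x) *\<^sub>R \<phi> x *\<^sub>R h x \<partial>lborel)" for \<phi> :: "'a \<Rightarrow> real" and k
        by (subst integral_scaleR_right[symmetric]) (simp add: mult_ac)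
      then show ?thesis
        by (simp add: A_def)
    qed
    show "A (\<lambda>x. f x + g x)" if "A f \<and> A g" for f g
      unfolding A_def
    proof (intro conjI allI impI)
      show "continuous_on UNIV (\<lambda>x. f x + g x)"
        using that by (auto simp: A_def intro: continuous_intros)
      fix \<phi> :: "'a \<Rightarrow> real" and k
      assume \<phi>: "continuous_on UNIV \<phi>" "\<forall>k. (\<integral>x. exp (k \<bullet> x) *\<^sub>R \<phi> x *\<^sub>R h x \<partial>lborel) = 0"
      have fg: "continuous_on UNIV f" "continuous_on UNIV g"
        using that by (auto simp: A_def)
      have "integrable lborel (\<lambda>x. exp (k \<bullet> x) *\<^sub>R (\<phi> x * f x) *\<^sub>R h x)"
        "integrable lborel (\<lambda>x. exp (k \<bullet> x) *\<^sub>R (\<phi> x * g x) *\<^sub>R h x)"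
        by (rule int[OF continuous_on_mult[OF \<phi>(1) fg(1)]] int[OF continuous_on_mult[OF \<phi>(1) fg(2)]])+
      then have "(\<integral>x. exp (k \<bullet> x) *\<^sub>R (\<phi> x * (f x + g x)) *\<^sub>R h x \<partial>lborel)
          = (\<integral>x. exp (k \<bullet> x) *\<^sub>R (\<phi> x * f x) *\<^sub>R h x \<partial>lborel)
          + (\<integral>x. exp (k \<bullet> x) *\<^sub>R (\<phi> x * g x) *\<^sub>R h x \<partial>lborel)"
        by (subst Bochner_Integration.integral_add[symmetric]) (auto simp: algebra_simps)
      then show "(\<integral>x. exp (k \<bullet> x) *\<^sub>R (\<phi> x * (f x + g x)) *\<^sub>R h x \<partial>lborel) = 0"
        using that \<phi> unfolding A_def by simp
    qed
    show "A (\<lambda>x. f x * g x)" if fg: "A f \<and> A g" for f g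
      unfolding A_def
    proof (intro conjI impI allI)
      show "continuous_on UNIV (\<lambda>x. f x * g x)"
        using that by (auto simp: A_def intro: continuous_intros)
      fix \<phi> :: "'a \<Rightarrow> real" and k
      assume \<phi>: "continuous_on UNIV \<phi>" "\<forall>k. (\<integral>x. exp (k \<bullet> x) *\<^sub>R \<phi> x *\<^sub>R h x \<partial>lborel) = 0"
      have "\<forall>k. (\<integral>x. exp (k \<bullet> x) *\<^sub>R (\<phi> x * f x) *\<^sub>R h x \<partial>lborel) = 0"
        using fg \<phi> unfolding A_def by blast
      moreover have "continuous_on UNIV (\<lambda>x. \<phi> x * f x)"
        using fg \<phi> unfolding A_def by (auto intro: continuous_intros)
      ultimately have "(\<integral>x. exp (k \<bullet> x) *\<^sub>R ((\<phi> x * f x) * g x) *\<^sub>R h x \<partial>lborel) = 0"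
        using fg unfolding A_def by blast
      then show "(\<integral>x. exp (k \<bullet> x) *\<^sub>R (\<phi> x * (f x * g x)) *\<^sub>R h x \<partial>lborel) = 0"
        by (simp add: mult.assoc)
    qed
    show "\<exists>f. A f \<and> f x \<noteq> f y" if "x \<in> K \<and> y \<in> K \<and> x \<noteq> y" for x y
    proof (intro exI conjI)
      let ?l = "x - y"
      have "(\<integral>x. exp (k \<bullet> x) *\<^sub>R (\<phi> x * exp (?l \<bullet> x)) *\<^sub>R h x \<partial>lborel)
          = (\<integral>x. exp ((k + ?l) \<bullet> x) *\<^sub>R \<phi> x *\<^sub>R h x \<partial>lborel)" for \<phi> :: "'a \<Rightarrow> real" and k
        by (simp only: inner_add_left exp_add scaleR_scaleR mult_ac)
      then show "A (\<lambda>x. exp (?l \<bullet> x))"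
        unfolding A_def by (auto intro!: continuous_intros)
      have "?l \<bullet> x - ?l \<bullet> y = ?l \<bullet> ?l"
        by (simp add: inner_diff_right)
      also have "\<dots> \<noteq> 0"
        using that by simp
      finally show "exp (?l \<bullet> x) \<noteq> exp (?l \<bullet> y)"
        by simp
    qed
  qed (use that in \<open>auto simp: A_def intro: continuous_on_subset\<close>)
  have orth: "(\<integral>x. g x * (h x \<bullet> b) \<partial>lborel) = 0" if g: "A g" for g b
  proof -
    have "\<forall>k. (\<integral>x. exp (k \<bullet> x) *\<^sub>R 1 *\<^sub>R h x \<partial>lborel) = 0"
      using zero by (simp add: laplace_def)
    from g[unfolded A_def, THEN conjunct2, THEN spec[of _ "\<lambda>_. 1"], THEN mp,
        OF continuous_on_const, THEN mp, OF this, THEN spec[of _ 0]]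
    have "(\<integral>x. g x *\<^sub>R h x \<partial>lborel) = 0"
      by simp
    then show ?thesis
      using integral_inner_left[of b lborel "\<lambda>x. g x *\<^sub>R h x"] int[of g 0] g by (simp add: A_def)
  qed
  have "h x \<bullet> b = 0" for b
  proof -
    let ?F = "\<lambda>x. h x \<bullet> b"
    have F: "continuous_on UNIV ?F"
      by (intro continuous_intros h)
    have intF: "integrable lborel (\<lambda>x. g x * ?F x)" if "continuous_on UNIV g" for g
      by (rule integrable_continuous_compact_support[OF _ K])
        (auto simp: supp intro!: continuous_intros h that)
    have intA: "integrable lborel (\<lambda>x. \<bar>?F x\<bar>)"
      using intF[of "\<lambda>_. 1"] by simp
    have "(\<integral>x. ?F x * ?F x \<partial>lborel) \<le> 0 + e" if e: "0 < e" for e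
    proof -
      define M where "M = (\<integral>x. \<bar>?F x\<bar> \<partial>lborel)"
      have "0 \<le> M"
        by (simp add: M_def)
      obtain g where g: "A g" "\<And>x. x \<in> K \<Longrightarrow> \<bar>?F x - g x\<bar> < e / (M + 1)"
        using approx[OF F, of "e / (M + 1)"] e \<open>0 \<le> M\<close> by auto
      have cg: "continuous_on UNIV g"
        using g by (simp add: A_def)
      have "(\<integral>x. ?F x * ?F x \<partial>lborel) = (\<integral>x. (?F x - g x) * ?F x \<partial>lborel)"
        using orth[OF g(1), of b] intF[OF F] intF[OF cg] by (simp add: algebra_simps)
      also have "\<dots> \<le> (\<integral>x. e / (M + 1) * \<bar>?F x\<bar> \<partial>lborel)"
      proof (rule integral_mono)
        show "(?F x - g x) * ?F x \<le> e / (M + 1) * \<bar>?F x\<bar>" for x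
        proof (cases "x \<in> K")
          case True
          have "(?F x - g x) * ?F x \<le> \<bar>?F x - g x\<bar> * \<bar>?F x\<bar>"
            by (simp flip: abs_mult)
          also have "\<dots> \<le> e / (M + 1) * \<bar>?F x\<bar>"
            using g(2)[OF True] by (intro mult_right_mono) auto
          finally show ?thesis .
        qed (simp add: supp)
      qed (use intF[OF continuous_on_diff[OF F cg]] intA in auto)
      also have "\<dots> = e / (M + 1) * M"
        by (simp add: M_def)
      also have "\<dots> \<le> e"
        using e \<open>0 \<le> M\<close> by (simp add: field_simps)
      finally show ?thesis
        by simp
    qed
    then have "(\<integral>x. ?F x * ?F x \<partial>lborel) \<le> 0"
      by (rule field_le_epsilon)
    then have "(\<integral>x. ?F x * ?F x \<partial>lborel) = 0"
      by (intro antisym integral_nonneg) auto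
    then have "AE x in lborel. ?F x * ?F x = 0"
      using integral_nonneg_eq_0_iff_AE[OF intF[OF F]] by auto
    then have AE: "AE x in lborel. ?F x = 0"
      by simp
    have "open {x. ?F x \<noteq> 0}"
      using F by (intro open_Collect_neq) auto
    then show ?thesis
      using AE_lborel_open[OF AE, of "{x. ?F x \<noteq> 0}"] by blast
  qed
  from this[of "h x"] show ?thesis
    by simp
qed

text \<open>
  On a hyperplane orthogonal to \<open>\<omega>\<close> the exponential is constant, so the transform on the line
  spanned by \<open>\<omega>\<close> sees only the integrals over these hyperplanes.
\<close>

lemma laplace_from_slices:
  fixes F G :: "'a::euclidean_space \<Rightarrow> real"
  assumes \<omega>: "norm \<omega> = 1" and K: "compact K"
    and F: "continuous_on UNIV F" "\<And>x. x \<notin> K \<Longrightarrow> F x = 0"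
    and G: "continuous_on UNIV G" "\<And>x. x \<notin> K \<Longrightarrow> G x = 0"
    and eq: "AE p in lborel. (\<integral>y. F (y + p *\<^sub>R \<omega>) \<partial>slice \<omega>) = c * (\<integral>y. G (y + p *\<^sub>R \<omega>) \<partial>slice \<omega>)"
  shows "(\<integral>x. F x * exp (\<sigma> * (\<omega> \<bullet> x)) \<partial>lborel) = c * (\<integral>x. G x * exp (\<sigma> * (\<omega> \<bullet> x)) \<partial>lborel)"
proof -
  interpret S: sigma_finite_measure "slice \<omega>"
    by (rule sigma_finite_slice[OF \<omega>])
  have [measurable]: "F \<in> borel_measurable borel" "G \<in> borel_measurable borel"
    using F G by (auto intro: borel_measurable_continuous_onI)
  have \<omega>\<omega>: "\<omega> \<bullet> \<omega> = 1"
    using \<omega> by (simp add: dot_square_norm)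
  have fubini: "(\<integral>x. f x * exp (\<sigma> * (\<omega> \<bullet> x)) \<partial>lborel)
      = (\<integral>p. exp (\<sigma> * p) * (\<integral>y. f (y + p *\<^sub>R \<omega>) \<partial>slice \<omega>) \<partial>lborel)"
    if f: "continuous_on UNIV f" "\<And>x. x \<notin> K \<Longrightarrow> f x = 0" for f
  proof -
    have [measurable]: "f \<in> borel_measurable borel"
      using f by (auto intro: borel_measurable_continuous_onI)
    have "integrable lborel (\<lambda>x. f x * exp (\<sigma> * (\<omega> \<bullet> x)))"
      by (rule integrable_continuous_compact_support[OF _ K]) (auto simp: f intro!: continuous_intros)
    then have "(\<integral>x. f x * exp (\<sigma> * (\<omega> \<bullet> x)) \<partial>lborel)
        = (\<integral>p. \<integral>y. f (y + p *\<^sub>R \<omega>) * exp (\<sigma> * (\<omega> \<bullet> (y + p *\<^sub>R \<omega>))) \<partial>slice \<omega> \<partial>lborel)"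
      by (rule integral_lborel_slice[OF \<omega>])
    also have "\<dots> = (\<integral>p. \<integral>y. exp (\<sigma> * p) * f (y + p *\<^sub>R \<omega>) \<partial>slice \<omega> \<partial>lborel)"
    proof (rule Bochner_Integration.integral_cong[OF refl])
      fix p :: real
      show "(\<integral>y. f (y + p *\<^sub>R \<omega>) * exp (\<sigma> * (\<omega> \<bullet> (y + p *\<^sub>R \<omega>))) \<partial>slice \<omega>)
          = (\<integral>y. exp (\<sigma> * p) * f (y + p *\<^sub>R \<omega>) \<partial>slice \<omega>)"
        by (rule integral_cong_AE)
          (use AE_slice_orthogonal[OF \<omega>] in \<open>auto simp: inner_add_right \<omega>\<omega> elim: eventually_mono\<close>)
    qed
    finally show ?thesis
      by simp
  qed
  have "(\<integral>p. exp (\<sigma> * p) * (\<integral>y. F (y + p *\<^sub>R \<omega>) \<partial>slice \<omega>) \<partial>lborel)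
      = (\<integral>p. c * (exp (\<sigma> * p) * (\<integral>y. G (y + p *\<^sub>R \<omega>) \<partial>slice \<omega>)) \<partial>lborel)"
    by (rule integral_cong_AE) (use eq in \<open>auto elim: eventually_mono\<close>)
  then show ?thesis
    by (simp add: fubini F G)
qed

text \<open>
  The hypothesis on the transform says that \<open>h\<close> is divergence free; the conclusion is its
  derivative at \<open>k\<close> in direction \<open>v\<close>.
\<close>

lemma laplace_divergence_derivative:
  fixes h :: "'a::euclidean_space \<Rightarrow> 'a"
  assumes h: "continuous_on UNIV h" and K: "compact K" and supp: "\<And>x. x \<notin> K \<Longrightarrow> h x = 0"
    and div: "\<And>k. laplace h k \<bullet> k = 0"
  shows "(\<integral>x. (x \<bullet> v) * (h x \<bullet> k) * exp (k \<bullet> x) \<partial>lborel) = - (laplace h k \<bullet> v)"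
proof -
  let ?e = "\<lambda>s x. exp ((k + s *\<^sub>R v) \<bullet> x)"
  let ?F = "\<lambda>s x. (h x \<bullet> (k + s *\<^sub>R v)) * ?e s x"
  let ?F' = "\<lambda>s x. ((h x \<bullet> v) + (x \<bullet> v) * (h x \<bullet> (k + s *\<^sub>R v))) * ?e s x"
  have [measurable]: "h \<in> borel_measurable borel"
    using h by (rule borel_measurable_continuous_onI)
  have cont: "continuous_on UNIV (?F s)" "continuous_on UNIV (?F' s)" for s
    by (intro continuous_intros h)+
  have "compact ((\<lambda>(s, x). ?F' s x) ` ({-1..1} \<times> K))"
    unfolding case_prod_beta
    by (intro compact_continuous_image compact_Times K continuous_intros
        continuous_on_compose2[OF h continuous_on_snd[OF continuous_on_id]]) auto
  then have "bounded ((\<lambda>(s, x). ?F' s x) ` ({-1..1} \<times> K))"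
    by (rule compact_imp_bounded)
  then obtain C where C: "\<forall>z\<in>(\<lambda>(s, x). ?F' s x) ` ({-1..1} \<times> K). norm z \<le> C"
    unfolding bounded_iff by blast
  have "((\<lambda>s. \<integral>x. ?F s x \<partial>lborel) has_real_derivative (\<integral>x. ?F' 0 x \<partial>lborel)) (at 0)"
  proof (rule has_real_derivative_integral[where g = "\<lambda>x. indicator K x * C"])
    show "integrable lborel (?F s)" for s
      by (rule integrable_continuous_compact_support[OF cont(1) K]) (simp add: supp)
    show "(\<lambda>x. ?F' 0 x) \<in> borel_measurable lborel"
      by measurable
    show "((\<lambda>s. ?F s x) has_real_derivative ?F' s x) (at s)" for s x
      by (simp add: inner_add_left inner_add_right)
        (auto intro!: derivative_eq_intros simp: algebra_simps inner_commute)
    show "\<bar>?F' s x\<bar> \<le> indicator K x * C" if "\<bar>s - 0\<bar> < 1" for s x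
    proof (cases "x \<in> K")
      case True
      then have "?F' s x \<in> (\<lambda>(s, x). ?F' s x) ` ({-1..1} \<times> K)"
        using that by (intro image_eqI[where x = "(s, x)"]) auto
      then show ?thesis
        using C True by auto
    qed (simp add: supp)
    show "integrable lborel (\<lambda>x. indicator K x * C)"
      using emeasure_bounded_finite[OF compact_imp_bounded[OF K]] borel_compact[OF K]
      by (intro integrable_mult_left integrable_real_indicator) auto
  qed
  moreover have "(\<lambda>s. \<integral>x. ?F s x \<partial>lborel) = (\<lambda>s. 0)"
  proof
    fix s
    have "(\<integral>x. ?F s x \<partial>lborel) = laplace h (k + s *\<^sub>R v) \<bullet> (k + s *\<^sub>R v)"
      by (rule inner_laplace[OF h K supp, symmetric])
    then show "(\<integral>x. ?F s x \<partial>lborel) = 0"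
      using div by simp
  qed
  ultimately have "(\<integral>x. ?F' 0 x \<partial>lborel) = 0"
    using DERIV_unique[OF DERIV_const] by fastforce
  moreover have "integrable lborel (\<lambda>x. (h x \<bullet> v) * exp (k \<bullet> x))"
      "integrable lborel (\<lambda>x. (x \<bullet> v) * (h x \<bullet> k) * exp (k \<bullet> x))"
    by (rule integrable_continuous_compact_support[OF _ K],
        intro continuous_intros h, simp add: supp)+
  ultimately show ?thesis
    by (simp add: inner_laplace[OF h K supp] distrib_right)
qed

text \<open>
  On the transform side, with \<open>k = \<sigma> *\<^sub>R \<omega>\<close>, \<open>L = laplace h k\<close> and \<open>v\<close> orthogonal to \<open>\<omega>\<close>: the
  first slice equation gives \<open>L \<bullet> \<omega> = 0\<close>. It holds for a dense set of directions, so by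
  continuity \<open>laplace h k \<bullet> k = 0\<close> for all \<open>k\<close> and may be differentiated. The second slice
  equation evaluates the same integral \<open>\<integral> (x \<bullet> v) * (h x \<bullet> k) * exp (k \<bullet> x)\<close> as
  \<open>- (n - 1) * (L \<bullet> v)\<close>, while differentiation gives \<open>- (L \<bullet> v)\<close>. Hence
  \<open>(n - 2) * (L \<bullet> v) = 0\<close>, and in dimension at least \<open>3\<close> the transform vanishes.
\<close>

lemma vanishing_from_slice_equations:
  fixes h :: "'a::euclidean_space \<Rightarrow> 'a"
  assumes dim: "DIM('a) \<ge> 3" and h: "continuous_on UNIV h" and K: "compact K"
    and supp: "\<And>x. x \<notin> K \<Longrightarrow> h x = 0"
    and D: "\<And>\<omega>. \<omega> \<in> D \<Longrightarrow> norm \<omega> = 1"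
    and dense: "\<And>\<omega> e. norm \<omega> = 1 \<Longrightarrow> 0 < e \<Longrightarrow> \<exists>\<omega>'\<in>D. dist \<omega>' \<omega> < e"
    and tower: "\<And>\<omega>. derivative_tower \<omega> K (H \<omega>)" and H0: "\<And>\<omega>. H \<omega> 0 = h"
    and slices: "\<And>\<omega>. \<omega> \<in> D \<Longrightarrow> AE p in lborel.
        (\<integral>y. H \<omega> (DIM('a) - 1) (y + p *\<^sub>R \<omega>) \<bullet> \<omega> \<partial>slice \<omega>) = 0 \<and>
        (\<forall>v. \<omega> \<bullet> v = 0 \<longrightarrow>
          (\<integral>y. (y \<bullet> v) * (H \<omega> (DIM('a) - 1) (y + p *\<^sub>R \<omega>) \<bullet> \<omega>) \<partial>slice \<omega>)
          = real (DIM('a) - 1) * (\<integral>y. H \<omega> (DIM('a) - 2) (y + p *\<^sub>R \<omega>) \<bullet> v \<partial>slice \<omega>))"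
  shows "h x = 0"
proof -
  note cont_laplace = continuous_laplace[OF h K supp]
  define n where "n = DIM('a) - 2"
  have n: "DIM('a) - 1 = Suc n" "DIM('a) - 2 = n" "1 \<le> n"
    using dim by (auto simp: n_def)
  have H: "continuous_on UNIV (H \<omega> m)" "\<And>x. x \<notin> K \<Longrightarrow> H \<omega> m x = 0" for \<omega> m
    using tower by (auto simp: derivative_tower_def)
  note slices = slices[unfolded n]
  have seq: "\<exists>u. (\<forall>j. u j \<in> D) \<and> u \<longlonglongrightarrow> \<omega>" if "norm \<omega> = 1" for \<omega>
  proof -
    have "\<omega> \<in> closure D"
      using dense[OF that] by (auto simp: closure_approachable)
    then show ?thesis
      by (auto simp: closure_sequential)
  qed
  have inner_laplace_ray: "laplace h (\<sigma> *\<^sub>R \<omega>) \<bullet> w = (\<integral>x. (h x \<bullet> w) * exp (\<sigma> * (\<omega> \<bullet> x)) \<partial>lborel)"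
    for \<sigma> \<omega> w
    by (simp add: inner_laplace[OF h K supp])
  have normal: "laplace h (\<sigma> *\<^sub>R \<omega>) \<bullet> \<omega> = 0" if \<omega>: "\<omega> \<in> D" and \<sigma>: "\<sigma> \<noteq> 0" for \<sigma> \<omega>
  proof -
    have "(\<integral>x. (H \<omega> (Suc n) x \<bullet> \<omega>) * exp (\<sigma> * (\<omega> \<bullet> x)) \<partial>lborel)
        = 0 * (\<integral>x. (H \<omega> (Suc n) x \<bullet> \<omega>) * exp (\<sigma> * (\<omega> \<bullet> x)) \<partial>lborel)"
      by (rule laplace_from_slices[OF D[OF \<omega>] K])
        (use slices[OF \<omega>] in \<open>auto simp: H intro!: continuous_intros elim: eventually_mono\<close>)
    then have "(- \<sigma>) ^ Suc n * (\<integral>x. (h x \<bullet> \<omega>) * exp (\<sigma> * (\<omega> \<bullet> x)) \<partial>lborel) = 0"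
      using laplace_derivative_tower[OF D[OF \<omega>] tower K, of "\<lambda>_. 1" "Suc n" \<omega> \<sigma>]
      by (simp add: H0)
    then show ?thesis
      using \<sigma> by (simp add: inner_laplace_ray)
  qed
  have div: "laplace h k \<bullet> k = 0" for k
  proof (cases "k = 0")
    case False
    then obtain u where u: "\<And>j. u j \<in> D" "u \<longlonglongrightarrow> sgn k"
      using seq[of "sgn k"] by (auto simp: norm_sgn)
    have "(\<lambda>j. laplace h (norm k *\<^sub>R u j) \<bullet> u j) \<longlonglongrightarrow> laplace h (norm k *\<^sub>R sgn k) \<bullet> sgn k"
      by (intro tendsto_intros u continuous_on_tendsto_compose[OF cont_laplace]) auto
    then have "laplace h (norm k *\<^sub>R sgn k) \<bullet> sgn k = 0"
      using False u(1) by (simp add: normal LIMSEQ_const_iff)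
    then show ?thesis
      using False by (simp add: sgn_div_norm)
  qed simp
  have tangential: "laplace h (\<sigma> *\<^sub>R \<omega>) \<bullet> v = 0"
    if \<omega>: "\<omega> \<in> D" and \<sigma>: "\<sigma> \<noteq> 0" and v: "\<omega> \<bullet> v = 0" for \<sigma> \<omega> v
  proof -
    have inv: "(x + s *\<^sub>R \<omega>) \<bullet> v = x \<bullet> v" for x s
      using v by (simp add: inner_add_left)
    let ?I = "\<integral>x. (x \<bullet> v) * (h x \<bullet> \<omega>) * exp (\<sigma> * (\<omega> \<bullet> x)) \<partial>lborel"
    have "(\<integral>x. (x \<bullet> v) * (H \<omega> (Suc n) x \<bullet> \<omega>) * exp (\<sigma> * (\<omega> \<bullet> x)) \<partial>lborel)
        = real (Suc n) * (\<integral>x. (H \<omega> n x \<bullet> v) * exp (\<sigma> * (\<omega> \<bullet> x)) \<partial>lborel)"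
    proof (rule laplace_from_slices[OF D[OF \<omega>] K])
      show "AE p in lborel. (\<integral>y. ((y + p *\<^sub>R \<omega>) \<bullet> v) * (H \<omega> (Suc n) (y + p *\<^sub>R \<omega>) \<bullet> \<omega>) \<partial>slice \<omega>)
          = real (Suc n) * (\<integral>y. H \<omega> n (y + p *\<^sub>R \<omega>) \<bullet> v \<partial>slice \<omega>)"
        using slices[OF \<omega>] v unfolding inv by (auto elim: eventually_mono)
    qed (auto simp: H intro!: continuous_intros)
    moreover have "(\<integral>x. (x \<bullet> v) * (H \<omega> (Suc n) x \<bullet> \<omega>) * exp (\<sigma> * (\<omega> \<bullet> x)) \<partial>lborel)
        = (- \<sigma>) ^ Suc n * ?I"
      using laplace_derivative_tower[OF D[OF \<omega>] tower K, of "\<lambda>x. x \<bullet> v" "Suc n" \<omega> \<sigma>] inv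
      by (simp add: H0 continuous_on_inner)
    moreover have "(\<integral>x. (H \<omega> n x \<bullet> v) * exp (\<sigma> * (\<omega> \<bullet> x)) \<partial>lborel)
        = (- \<sigma>) ^ n * (laplace h (\<sigma> *\<^sub>R \<omega>) \<bullet> v)"
      using laplace_derivative_tower[OF D[OF \<omega>] tower K, of "\<lambda>_. 1" n v \<sigma>]
      by (simp add: H0 inner_laplace_ray)
    ultimately have "(- \<sigma>) ^ n * (- \<sigma> * ?I) = (- \<sigma>) ^ n * (real (Suc n) * (laplace h (\<sigma> *\<^sub>R \<omega>) \<bullet> v))"
      by (simp only: power_Suc mult_ac)
    then have "- \<sigma> * ?I = real (Suc n) * (laplace h (\<sigma> *\<^sub>R \<omega>) \<bullet> v)"
      using \<sigma> by (subst (asm) mult_cancel_left) simp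
    moreover have "\<sigma> * ?I = - (laplace h (\<sigma> *\<^sub>R \<omega>) \<bullet> v)"
      using laplace_divergence_derivative[OF h K supp div, of v "\<sigma> *\<^sub>R \<omega>"]
      by (simp add: mult_ac)
    ultimately have "real n * (laplace h (\<sigma> *\<^sub>R \<omega>) \<bullet> v) = 0"
      by (simp add: algebra_simps)
    then show ?thesis
      using n(3) by simp
  qed
  have on_D: "laplace h (\<sigma> *\<^sub>R \<omega>) = 0" if \<omega>: "\<omega> \<in> D" and \<sigma>: "\<sigma> \<noteq> 0" for \<sigma> \<omega>
  proof -
    define L where "L = laplace h (\<sigma> *\<^sub>R \<omega>)"
    have "L \<bullet> \<omega> = 0"
      unfolding L_def by (rule normal[OF \<omega> \<sigma>])
    then have "L \<bullet> L = 0"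
      using tangential[OF \<omega> \<sigma>, of L] by (simp add: L_def inner_commute)
    then show ?thesis
      by (simp add: L_def)
  qed
  have nonzero: "laplace h k = 0" if k: "k \<noteq> 0" for k
  proof -
    obtain u where u: "\<And>j. u j \<in> D" "u \<longlonglongrightarrow> sgn k"
      using seq[of "sgn k"] k by (auto simp: norm_sgn)
    have "(\<lambda>j. laplace h (norm k *\<^sub>R u j)) \<longlonglongrightarrow> laplace h (norm k *\<^sub>R sgn k)"
      by (intro tendsto_intros u continuous_on_tendsto_compose[OF cont_laplace]) auto
    then show ?thesis
      using k u(1) by (simp add: on_D LIMSEQ_const_iff sgn_div_norm)
  qed
  have all: "laplace h k = 0" for k
  proof (cases "k = 0")
    case True
    obtain b :: 'a where b: "b \<in> Basis"
      using nonempty_Basis by blast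
    have "(\<lambda>j. laplace h (inverse (real (Suc j)) *\<^sub>R b)) \<longlonglongrightarrow> laplace h (0 *\<^sub>R b)"
      by (intro tendsto_intros LIMSEQ_inverse_real_of_nat
          continuous_on_tendsto_compose[OF cont_laplace]) auto
    then show ?thesis
      using True b by (simp add: nonzero LIMSEQ_const_iff nonzero_Basis)
  qed (rule nonzero)
  show ?thesis
    using h K supp all by (rule laplace_injective)
qed

section \<open>Directional derivatives of smooth fields\<close>

fun iterated_derivative :: "'a \<Rightarrow> ('a::real_normed_vector \<Rightarrow> 'b::real_normed_vector) \<Rightarrow> nat \<Rightarrow> 'a \<Rightarrow> 'b" where
  "iterated_derivative \<omega> f 0 = f"
| "iterated_derivative \<omega> f (Suc m) = (\<lambda>x. frechet_derivative (iterated_derivative \<omega> f m) (at x) \<omega>)"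

lemma smooth_on_iterated_derivative:
  assumes "smooth_on S f"
  shows "smooth_on S (iterated_derivative \<omega> f m)"
proof (induction m)
  case (Suc m)
  then have "Ck_on (Suc k) S (iterated_derivative \<omega> f m)" for k
    unfolding smooth_on_def by blast
  then show ?case
    by (simp add: smooth_on_def)
qed (use assms in simp)

lemma iterated_derivative_vanishes:
  fixes f :: "'a::real_normed_vector \<Rightarrow> 'b::real_normed_vector"
  assumes "x \<notin> fun_support f"
  shows "iterated_derivative \<omega> f m x = 0"
  using assms
proof (induction m arbitrary: x)
  case 0
  then show ?case
    using closure_subset[of "{x. f x \<noteq> 0}"] by (auto simp: fun_support_def)
next
  case (Suc m)
  have "open (- fun_support f)"
    by (auto simp: fun_support_def)
  have "((\<lambda>_. 0) has_derivative (\<lambda>_. 0)) (at x)"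
    by simp
  then have "(iterated_derivative \<omega> f m has_derivative (\<lambda>_. 0)) (at x)"
    by (rule has_derivative_transform_within_open[OF _ \<open>open (- fun_support f)\<close>])
      (use Suc in auto)
  then show ?case
    by (simp add: frechet_derivative_at[symmetric])
qed

lemma iterated_derivative_step:
  assumes "smooth_on UNIV f"
  shows "((\<lambda>s. iterated_derivative \<omega> f m (x + s *\<^sub>R \<omega>)) has_vector_derivative
    iterated_derivative \<omega> f (Suc m) (x + s *\<^sub>R \<omega>)) (at s)"
proof -
  let ?D = "frechet_derivative (iterated_derivative \<omega> f m) (at (x + s *\<^sub>R \<omega>))"
  have "Ck_on (Suc 0) UNIV (iterated_derivative \<omega> f m)"
    using smooth_on_iterated_derivative[OF assms] by (auto simp only: smooth_on_def)
  then have D: "(iterated_derivative \<omega> f m has_derivative ?D) (at (x + s *\<^sub>R \<omega>))"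
    by (simp add: frechet_derivative_works)
  have "((\<lambda>s. x + s *\<^sub>R \<omega>) has_derivative (\<lambda>t. t *\<^sub>R \<omega>)) (at s)"
    by (auto intro!: derivative_eq_intros)
  from has_derivative_compose[OF this D] show ?thesis
    using has_derivative_linear[OF D] by (simp add: has_vector_derivative_def linear_scale)
qed

lemma derivative_tower_difference:
  fixes f g :: "'a::real_normed_vector \<Rightarrow> 'b::real_normed_vector"
  assumes f: "smooth_on UNIV f" and g: "smooth_on UNIV g"
  shows "derivative_tower \<omega> (fun_support f \<union> fun_support g)
    (\<lambda>m x. iterated_derivative \<omega> f m x - iterated_derivative \<omega> g m x)"
proof -
  have "continuous_on UNIV (iterated_derivative \<omega> f m)" if "smooth_on UNIV f"
    for m and f :: "'a \<Rightarrow> 'b"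
  proof -
    have "Ck_on 0 UNIV (iterated_derivative \<omega> f m)"
      using smooth_on_iterated_derivative[OF that] by (simp only: smooth_on_def)
    then show ?thesis
      by simp
  qed
  then show ?thesis
    unfolding derivative_tower_def using f g
    by (auto intro!: continuous_on_diff has_vector_derivative_diff iterated_derivative_step
        simp: iterated_derivative_vanishes simp del: iterated_derivative.simps)
qed

section \<open>The transverse data along rays\<close>

text \<open>
  The data determine the components of the integrals over full lines that are orthogonal to the
  line, so the line integrals of \<open>f - g\<close> are parallel to the line. As the curve encompasses the
  domain, one of the two rays from \<open>a\<close> misses it, and the integral over the other ray is either
  the integral over the line or \<open>0\<close>. Since \<open>norm \<xi> \<ge> 1\<close>, parameters beyond \<open>T\<close> leave the
  support.
\<close>

lemma ray_integral_parallel: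
  fixes f g :: "real ^ 'n::finite \<Rightarrow> real ^ 'n"
  assumes idx: "coordinate_labelling idx" and ang: "angle_choice idx ang"
    and f: "continuous_on UNIV f" "compact Kf" "\<And>x. x \<notin> Kf \<Longrightarrow> f x = 0"
    and g: "continuous_on UNIV g" "compact Kg" "\<And>x. x \<notin> Kg \<Longrightarrow> g x = 0"
    and B: "Kf \<union> Kg \<subseteq> B" "Kf \<union> Kg \<subseteq> cball a T"
    and enc: "encompasses \<gamma> B" and a: "a \<in> \<gamma>"
    and eq: "\<forall>a\<in>\<gamma>. \<forall>\<xi>\<in>sphere 0 1. \<forall>i\<in>{1..CARD('n) - 1}.
           transverse_ray_transform idx ang i f a \<xi> = transverse_ray_transform idx ang i g a \<xi>"
    and \<xi>: "1 \<le> norm \<xi>"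
  shows "\<exists>c. (\<integral>t. indicator {0..T} t *\<^sub>R (f (a + t *\<^sub>R \<xi>) - g (a + t *\<^sub>R \<xi>)) \<partial>lborel) = c *\<^sub>R \<xi>"
proof -
  let ?h = "\<lambda>x. f x - g x"
  let ?K = "Kf \<union> Kg"
  define u where "u = sgn \<xi>"
  have "\<xi> \<noteq> 0"
    using \<xi> by auto
  then have \<xi>u: "\<xi> = norm \<xi> *\<^sub>R u" and u: "norm u = 1" "norm \<xi> > 0"
    by (simp_all add: u_def norm_sgn) (simp add: sgn_div_norm)
  have int: "integrable lborel (\<lambda>t. p (a + t *\<^sub>R u))"
    if p: "continuous_on UNIV p" "compact L" "\<And>x. x \<notin> L \<Longrightarrow> p x = 0"
    for p :: "real ^ 'n \<Rightarrow> real ^ 'n" and L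
  proof (rule integrable_continuous_compact_support)
    show "continuous_on UNIV (\<lambda>t. p (a + t *\<^sub>R u))"
      by (intro continuous_on_compose2[OF p(1)] continuous_intros) auto
    show "compact ((\<lambda>x. (x - a) \<bullet> u) ` L)"
      by (intro compact_continuous_image p continuous_intros)
    show "p (a + t *\<^sub>R u) = 0" if "t \<notin> (\<lambda>x. (x - a) \<bullet> u) ` L" for t
    proof (rule p(3))
      have "(a + t *\<^sub>R u - a) \<bullet> u = t"
        using u by (simp add: dot_square_norm)
      then show "a + t *\<^sub>R u \<notin> L"
        using that by (metis imageI)
    qed
  qed
  have intf: "integrable lborel (\<lambda>t. f (a + t *\<^sub>R u))"
    using f by (rule int)
  have intg: "integrable lborel (\<lambda>t. g (a + t *\<^sub>R u))"
    using g by (rule int)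
  define X where "X = (\<integral>t. ?h (a + t *\<^sub>R u) \<partial>lborel)"
  have "X \<bullet> frame_vector idx (ang u) i = 0" if "i \<in> {1..CARD('n) - 1}" for i
  proof -
    let ?e = "frame_vector idx (ang u) i"
    have "transverse_ray_transform idx ang i f a u = transverse_ray_transform idx ang i g a u"
      using eq a u that by simp
    then have "(\<integral>t. f (a + t *\<^sub>R u) \<partial>lborel) \<bullet> ?e = (\<integral>t. g (a + t *\<^sub>R u) \<partial>lborel) \<bullet> ?e"
      using intf intg by (simp add: transverse_ray_transform_def)
    then show ?thesis
      unfolding X_def using intf intg by (simp add: inner_diff_left)
  qed
  from parallel_if_orthogonal_to_frame[OF idx this] obtain c where c: "X = c *\<^sub>R u"
    using ang u by (auto simp: angle_choice_def)
  define I where "I = (\<integral>t. ?h (a + t *\<^sub>R \<xi>) \<partial>lborel)"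
  have scale: "t *\<^sub>R \<xi> = (norm \<xi> * t) *\<^sub>R u" for t
    by (subst \<xi>u) (simp add: mult.commute)
  have "X = norm \<xi> *\<^sub>R I"
    unfolding X_def I_def
    by (subst lborel_integral_real_affine[where c = "norm \<xi>" and t = 0])
      (use u in \<open>simp_all add: scale\<close>)
  with c have I: "norm \<xi> *\<^sub>R I = c *\<^sub>R u"
    by simp
  have "I = (1 / (norm \<xi> * norm \<xi>)) *\<^sub>R (norm \<xi> *\<^sub>R (norm \<xi> *\<^sub>R I))"
    using u(2) by simp
  also have "norm \<xi> *\<^sub>R (norm \<xi> *\<^sub>R I) = c *\<^sub>R \<xi>"
    unfolding I by (subst (2) \<xi>u) (simp add: mult.commute)
  finally have full: "I = (1 / (norm \<xi> * norm \<xi>) * c) *\<^sub>R \<xi>"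
    by simp
  have far: "?h (a + t *\<^sub>R \<xi>) = 0" if "T < t" for t
  proof (cases "a + t *\<^sub>R \<xi> \<in> ?K")
    case True
    then have "norm (t *\<^sub>R \<xi>) \<le> T"
      using B(2) by (auto simp: dist_norm subset_iff)
    moreover have "\<bar>t\<bar> \<le> norm (t *\<^sub>R \<xi>)"
      using \<xi> by (simp add: mult_le_cancel_left1)
    ultimately show ?thesis
      using that by simp
  qed (simp add: f g)
  have outside: "?h x = 0" if "x \<notin> B" for x
    using that B(1) f(3)[of x] g(3)[of x] by (metis UnCI diff_0_right subsetD)
  from enc a \<open>\<xi> \<noteq> 0\<close> have "\<not> ({a + t *\<^sub>R \<xi> | t. 0 \<le> t} \<inter> B \<noteq> {} \<and> {a + t *\<^sub>R \<xi> | t. t \<le> 0} \<inter> B \<noteq> {})"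
    unfolding encompasses_def by blast
  then consider "\<And>t. 0 \<le> t \<Longrightarrow> a + t *\<^sub>R \<xi> \<notin> B" | "\<And>t. t \<le> 0 \<Longrightarrow> a + t *\<^sub>R \<xi> \<notin> B"
    by blast
  then show ?thesis
  proof cases
    case 1
    then have "indicator {0..T} t *\<^sub>R ?h (a + t *\<^sub>R \<xi>) = 0" for t
      using outside by (auto simp: indicator_def)
    then show ?thesis
      by (intro exI[of _ 0]) (simp only: scaleR_zero_left integral_zero)
  next
    case 2
    have "indicator {0..T} t *\<^sub>R ?h (a + t *\<^sub>R \<xi>) = ?h (a + t *\<^sub>R \<xi>)" for t
    proof (cases "t \<in> {0..T}")
      case False
      then show ?thesis
        using far[of t] outside[OF 2[of t]] by (cases "0 \<le> t") auto
    qed simp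
    then show ?thesis
      using full by (auto simp: I_def)
  qed
qed

section \<open>The Kirillov-Tuy condition\<close>

lemma sgn_measurable_ball_sphere:
  "sgn \<in> restrict_space lborel (ball 0 1 - {0}) \<rightarrow>\<^sub>M restrict_space borel (sphere 0 1 :: 'a::euclidean_space set)"
proof (rule measurable_restrict_space2)
  have "(sgn :: 'a \<Rightarrow> 'a) \<in> borel_measurable borel"
    unfolding sgn_div_norm[abs_def] by measurable
  then show "(sgn :: 'a \<Rightarrow> 'a) \<in> borel_measurable (restrict_space lborel (ball 0 1 - {0}))"
    by (intro measurable_restrict_space1) simp
qed (auto simp: norm_sgn space_restrict_space)

text \<open>
  The measure on the sphere is a cone measure, so a null set of directions spans a null cone, and
  the cone over a neighbourhood of \<open>\<omega>\<close> has positive volume.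
\<close>

lemma AE_sphere_measure_dense:
  fixes \<omega> :: "'a::euclidean_space"
  assumes AE: "AE \<omega> in sphere_measure. Q \<omega>" and \<omega>: "norm \<omega> = 1" and e: "0 < e"
  shows "\<exists>\<omega>'. norm \<omega>' = 1 \<and> Q \<omega>' \<and> dist \<omega>' \<omega> < e"
proof -
  let ?D = "distr (restrict_space lborel (ball 0 1 - {0})) (restrict_space borel (sphere 0 1)) (sgn :: 'a \<Rightarrow> 'a)"
  obtain N where N: "{\<omega> \<in> space sphere_measure. \<not> Q \<omega>} \<subseteq> N" "emeasure sphere_measure N = 0"
      "N \<in> sets sphere_measure"
    using AE by (rule AE_E)
  have "AE \<omega> in ?D. Q \<omega>"
  proof (rule AE_I)
    show "{\<omega> \<in> space ?D. \<not> Q \<omega>} \<subseteq> N" "N \<in> sets ?D"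
      using N by (auto simp: sphere_measure_def space_scale_measure)
    show "emeasure ?D N = 0"
      using N(2) by (simp add: sphere_measure_def)
  qed
  then have "AE x in restrict_space lborel (ball 0 1 - {0}). Q (sgn x)"
    by (rule AE_distrD[OF sgn_measurable_ball_sphere])
  then have AE': "AE x in lborel. x \<in> ball 0 1 - {0} \<longrightarrow> Q (sgn x)"
    by (subst (asm) AE_restrict_space_iff) auto
  define U where "U = {x \<in> ball 0 1 - {0}. dist (sgn x) \<omega> < e}"
  have "open U"
  proof -
    have "U = (ball 0 1 - {0}) \<inter> (\<lambda>x. dist (sgn x) \<omega>) -` {..<e}"
      by (auto simp: U_def)
    moreover have "continuous_on (ball 0 1 - {0}) (\<lambda>x. dist (sgn x) \<omega>)"
      unfolding sgn_div_norm by (intro continuous_intros) auto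
    ultimately show ?thesis
      by (simp add: continuous_open_preimage open_ball open_delete)
  qed
  moreover have "(1 / 2) *\<^sub>R \<omega> \<in> U"
    using \<omega> e by (auto simp: U_def sgn_scaleR sgn_div_norm)
  ultimately obtain x where "x \<in> U" "x \<in> ball 0 1 - {0} \<longrightarrow> Q (sgn x)"
    using AE_lborel_open[OF AE'] by blast
  then show ?thesis
    by (intro exI[of _ "sgn x"]) (auto simp: U_def norm_sgn)
qed

lemma AE_hyperplane_measure_open:
  fixes \<omega> :: "'a::euclidean_space"
  assumes AE: "AE x in hyperplane_measure \<omega> p. P x" and \<omega>: "norm \<omega> = 1"
    and B: "open B" "hyperplane \<omega> p \<inter> B \<noteq> {}"
  shows "\<exists>x\<in>hyperplane \<omega> p \<inter> B. P x"
proof -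
  let ?S = "{x. p \<le> \<omega> \<bullet> x \<and> \<omega> \<bullet> x \<le> p + 1}"
  let ?P = "\<lambda>x. x - (\<omega> \<bullet> x - p) *\<^sub>R \<omega>"
  have \<omega>\<omega>: "\<omega> \<bullet> \<omega> = 1"
    using \<omega> by (simp add: dot_square_norm)
  have meas: "?P \<in> restrict_space lborel ?S \<rightarrow>\<^sub>M restrict_space borel (hyperplane \<omega> p)"
    by (intro measurable_restrict_space2 measurable_restrict_space1)
      (auto simp: hyperplane_def inner_diff_right \<omega>\<omega> space_restrict_space)
  have "AE x in restrict_space lborel ?S. P (?P x)"
    using AE unfolding hyperplane_measure_def by (rule AE_distrD[OF meas])
  then have AE': "AE x in lborel. x \<in> ?S \<longrightarrow> P (?P x)"
    by (subst (asm) AE_restrict_space_iff) auto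
  \<comment> \<open>The open part of the cylinder of height \<open>1\<close> over \<open>B\<close> in the hyperplane.\<close>
  define U where "U = {x. p < \<omega> \<bullet> x} \<inter> {x. \<omega> \<bullet> x < p + 1} \<inter> ?P -` B"
  have "open U"
    unfolding U_def
    by (intro open_Int open_Collect_less open_vimage B continuous_intros)
  moreover have "U \<noteq> {}"
  proof -
    obtain z where z: "z \<in> B" "\<omega> \<bullet> z = p"
      using B(2) by (auto simp: hyperplane_def)
    then have "z + (1 / 2) *\<^sub>R \<omega> \<in> U"
      by (simp add: U_def inner_add_right \<omega>\<omega>)
    then show ?thesis
      by blast
  qed
  ultimately obtain x where "x \<in> U" "x \<in> ?S \<longrightarrow> P (?P x)"
    using AE_lborel_open[OF AE'] by blast
  then show ?thesis
    by (intro bexI[of _ "?P x"]) (auto simp: U_def hyperplane_def inner_diff_right \<omega>\<omega>)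
qed

lemma finite_sphere_measure: "finite_measure (sphere_measure :: 'a::euclidean_space measure)"
proof
  let ?R = "restrict_space lborel (ball 0 1 - {0}) :: 'a measure"
  let ?D = "distr ?R (restrict_space borel (sphere 0 1)) sgn"
  have sgn: "sgn \<in> ?R \<rightarrow>\<^sub>M restrict_space borel (sphere 0 1)"
    by (rule sgn_measurable_ball_sphere)
  have "emeasure ?D (space ?D) = emeasure ?R (sgn -` space ?D \<inter> space ?R)"
    by (rule emeasure_distr[OF sgn]) (metis sets.top space_distr)
  also have "\<dots> \<le> emeasure ?R (space ?R)"
    by (intro emeasure_mono Int_lower2 sets.top)
  also have "\<dots> = emeasure lborel (ball 0 1 - {0} :: 'a set)"
    by (simp add: emeasure_restrict_space space_restrict_space)
  also have "\<dots> < \<infinity>"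
    by (rule emeasure_bounded_finite) (simp add: bounded_diff)
  finally have "emeasure ?D (space ?D) < \<infinity>" .
  then show "emeasure (sphere_measure :: 'a measure) (space sphere_measure) \<noteq> (\<infinity> :: ennreal)"
    by (simp add: sphere_measure_def space_scale_measure ennreal_mult_eq_top_iff)
qed

text \<open>
  What the uniqueness proof keeps of the condition: on almost every hyperplane that meets the
  domain there are two points of the curve and some point that is not collinear with them.
\<close>

lemma kirillov_tuy_points:
  fixes B :: "'a::euclidean_space set"
  assumes KT: "modified_kirillov_tuy B \<gamma>" and B: "open B"
  shows "AE \<omega> in sphere_measure. norm \<omega> = 1 \<longrightarrow> (AE p in lborel. hyperplane \<omega> p \<inter> B \<noteq> {} \<longrightarrow>
    (\<exists>a\<in>\<gamma> \<inter> hyperplane \<omega> p. \<exists>a'\<in>\<gamma> \<inter> hyperplane \<omega> p. \<exists>x\<in>hyperplane \<omega> p.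
        lin_indep_pair (x - a) (x - a')))"
proof -
  interpret S: finite_measure "sphere_measure :: 'a measure"
    by (rule finite_sphere_measure)
  interpret P: pair_sigma_finite "sphere_measure :: 'a measure" "lborel :: real measure" ..
  have point: "\<exists>a\<in>\<gamma> \<inter> hyperplane \<omega> p. \<exists>a'\<in>\<gamma> \<inter> hyperplane \<omega> p. \<exists>x\<in>hyperplane \<omega> p.
        lin_indep_pair (x - a) (x - a')"
    if \<omega>: "norm \<omega> = 1" and hit: "hyperplane \<omega> p \<inter> B \<noteq> {}"
      and U: "(\<omega>, p) \<in> U" "\<forall>(\<omega>', p')\<in>U. norm \<omega>' = 1 \<longrightarrow>
              \<gamma>\<^sub>1 (\<omega>', p') \<in> hyperplane \<omega>' p' \<inter> \<gamma> \<and> \<gamma>\<^sub>2 (\<omega>', p') \<in> hyperplane \<omega>' p' \<inter> \<gamma>"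
      and AE: "AE x in hyperplane_measure \<omega> p. x \<in> B \<longrightarrow>
              lin_indep_pair (x - \<gamma>\<^sub>1 (\<omega>, p)) (x - \<gamma>\<^sub>2 (\<omega>, p))"
    for \<omega> p U and \<gamma>\<^sub>1 \<gamma>\<^sub>2 :: "'a \<times> real \<Rightarrow> 'a"
  proof -
    obtain x where "x \<in> hyperplane \<omega> p" "lin_indep_pair (x - \<gamma>\<^sub>1 (\<omega>, p)) (x - \<gamma>\<^sub>2 (\<omega>, p))"
      using AE_hyperplane_measure_open[OF AE \<omega> B hit] by blast
    moreover have "\<gamma>\<^sub>1 (\<omega>, p) \<in> \<gamma> \<inter> hyperplane \<omega> p" "\<gamma>\<^sub>2 (\<omega>, p) \<in> \<gamma> \<inter> hyperplane \<omega> p"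
      using U \<omega> by auto
    ultimately show ?thesis
      by blast
  qed
  have "AE z in sphere_measure \<Otimes>\<^sub>M lborel. norm (fst z) = 1 \<longrightarrow> hyperplane (fst z) (snd z) \<inter> B \<noteq> {} \<longrightarrow>
    (\<exists>a\<in>\<gamma> \<inter> hyperplane (fst z) (snd z). \<exists>a'\<in>\<gamma> \<inter> hyperplane (fst z) (snd z).
        \<exists>x\<in>hyperplane (fst z) (snd z). lin_indep_pair (x - a) (x - a'))"
    using KT unfolding modified_kirillov_tuy_def
    by (rule eventually_mono) (clarsimp split: prod.splits, use point in \<open>blast\<close>)
  from P.AE_pair[OF this] show ?thesis
    by (auto elim!: eventually_mono)
qed

lemma lin_indep_pair_in_hyperplane_dim:
  fixes \<omega> :: "'a::euclidean_space"
  assumes "norm \<omega> = 1" and "a \<in> hyperplane \<omega> p" "a' \<in> hyperplane \<omega> p" "x \<in> hyperplane \<omega> p"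
    and ind: "lin_indep_pair (x - a) (x - a')"
  shows "DIM('a) \<ge> 3"
proof -
  have "{x - a, x - a'} \<subseteq> {y. \<omega> \<bullet> y = 0}"
    using assms by (auto simp: hyperplane_def inner_diff_right)
  then have "card {x - a, x - a'} \<le> dim {y. \<omega> \<bullet> y = 0}"
    using ind by (intro independent_card_le_dim) (auto simp: lin_indep_pair_def)
  moreover have "card {x - a, x - a'} = 2"
    using ind by (auto simp: lin_indep_pair_def)
  moreover have "dim {y. \<omega> \<bullet> y = 0} = DIM('a) - 1"
    using assms by (intro dim_hyperplane) auto
  ultimately show ?thesis
    by linarith
qed

text \<open>
  In the plane a hyperplane is a line, where \<open>x - \<gamma>\<^sub>1\<close> and \<open>x - \<gamma>\<^sub>2\<close> are always dependent, so
  the condition excludes dimension \<open>2\<close>. This is essential: in the plane the transverse data of a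
  rotated gradient of a compactly supported function vanish.
\<close>

lemma kirillov_tuy_dim:
  fixes B :: "'a::euclidean_space set"
  assumes KT: "modified_kirillov_tuy B \<gamma>" and B: "open B" "B \<noteq> {}"
  shows "DIM('a) \<ge> 3"
proof -
  obtain e :: 'a where e: "e \<in> Basis"
    using nonempty_Basis by blast
  obtain \<omega> where \<omega>: "norm \<omega> = 1" and AE: "AE p in lborel. hyperplane \<omega> p \<inter> B \<noteq> {} \<longrightarrow>
      (\<exists>a\<in>\<gamma> \<inter> hyperplane \<omega> p. \<exists>a'\<in>\<gamma> \<inter> hyperplane \<omega> p. \<exists>x\<in>hyperplane \<omega> p.
          lin_indep_pair (x - a) (x - a'))"
    using AE_sphere_measure_dense[OF kirillov_tuy_points[OF KT B(1)] norm_Basis[OF e] zero_less_one]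
    by blast
  obtain b where b: "b \<in> B"
    using B by blast
  let ?V = "(\<lambda>p. b + (p - \<omega> \<bullet> b) *\<^sub>R \<omega>) -` B"
  have "open ?V"
    by (intro open_vimage B continuous_intros)
  moreover have "\<omega> \<bullet> b \<in> ?V"
    using b by simp
  ultimately obtain p where p: "p \<in> ?V" "hyperplane \<omega> p \<inter> B \<noteq> {} \<longrightarrow>
      (\<exists>a\<in>\<gamma> \<inter> hyperplane \<omega> p. \<exists>a'\<in>\<gamma> \<inter> hyperplane \<omega> p. \<exists>x\<in>hyperplane \<omega> p.
          lin_indep_pair (x - a) (x - a'))"
    using AE_lborel_open[OF AE, of ?V] by blast
  have "b + (p - \<omega> \<bullet> b) *\<^sub>R \<omega> \<in> hyperplane \<omega> p"
    using \<omega> by (simp add: hyperplane_def inner_add_right dot_square_norm)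
  then show ?thesis
    using p lin_indep_pair_in_hyperplane_dim[OF \<omega>] by blast
qed

section \<open>Uniqueness\<close>

theorem theorem2:
  fixes B \<gamma> :: "(real ^ 'n::finite) set"
    and idx :: "'n \<Rightarrow> nat"
    and ang :: "real ^ 'n \<Rightarrow> nat \<Rightarrow> real"
    and f g :: "real ^ 'n \<Rightarrow> real ^ 'n"
  assumes "2 \<le> CARD('n)"
    and "coordinate_labelling idx"
    and "angle_choice idx ang"
    and "open B" and "connected B" and "B \<noteq> {}" and "bounded B"
    and "is_curve \<gamma>"
    and "modified_kirillov_tuy B \<gamma>"
    and "encompasses \<gamma> B"
    and "smooth_on UNIV f" and "compact (fun_support f)" and "fun_support f \<subseteq> B"
    and "smooth_on UNIV g" and "compact (fun_support g)" and "fun_support g \<subseteq> B"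
    and "\<forall>a\<in>\<gamma>. \<forall>\<xi>\<in>sphere 0 1. \<forall>i\<in>{1..CARD('n) - 1}.
           transverse_ray_transform idx ang i f a \<xi> = transverse_ray_transform idx ang i g a \<xi>"
  shows "f = g"
proof -
  note KT = assms(9) and enc = assms(10) and data = assms(17)
  note f = assms(11-13) and g = assms(14-16)
  define K where "K = fun_support f \<union> fun_support g"
  define H where "H \<omega> m x = iterated_derivative \<omega> f m x - iterated_derivative \<omega> g m x" for \<omega> m x
  have K: "compact K" "K \<subseteq> B"
    using f g by (auto simp: K_def)
  have tower: "derivative_tower \<omega> K (H \<omega>)" for \<omega>
    unfolding K_def H_def[abs_def] by (rule derivative_tower_difference[OF f(1) g(1)])
  have H0: "H \<omega> 0 = (\<lambda>x. f x - g x)" for \<omega>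
    by (simp add: H_def[abs_def])
  have cont_h: "continuous_on UNIV (\<lambda>x. f x - g x)"
    using tower[of 0] unfolding derivative_tower_def H0[of 0, symmetric] by blast
  have supp: "H \<omega> m x = 0" if "x \<notin> K" for \<omega> m x
    using tower that by (auto simp: derivative_tower_def)
  have supp_h: "f x - g x = 0" if "x \<notin> K" for x
    using supp[OF that, of 0 0] by (simp add: H0)
  have cont: "continuous_on UNIV u" and zero: "\<And>x. x \<notin> fun_support u \<Longrightarrow> u x = 0"
    if "smooth_on UNIV u" for u :: "real ^ 'n \<Rightarrow> real ^ 'n"
    using that Ck_on.simps(1)[of UNIV u] iterated_derivative_vanishes[of _ u 0 0]
    by (auto simp: smooth_on_def simp del: Ck_on.simps)
  have dim: "DIM(real ^ 'n) \<ge> 3"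
    by (rule kirillov_tuy_dim[OF KT assms(4,6)])
  let ?n = "DIM(real ^ 'n)"
  let ?good = "\<lambda>\<omega>. norm \<omega> = 1 \<longrightarrow> (AE p in lborel. hyperplane \<omega> p \<inter> B \<noteq> {} \<longrightarrow>
    (\<exists>a\<in>\<gamma> \<inter> hyperplane \<omega> p. \<exists>a'\<in>\<gamma> \<inter> hyperplane \<omega> p. \<exists>x\<in>hyperplane \<omega> p.
        lin_indep_pair (x - a) (x - a')))"
  define D where "D = {\<omega>. norm \<omega> = 1 \<and> ?good \<omega>}"
  have "f x - g x = 0" for x
  proof (rule vanishing_from_slice_equations[where H = H and D = D, OF dim cont_h K(1) supp_h])
    show "\<exists>\<omega>'\<in>D. dist \<omega>' \<omega> < e" if "norm \<omega> = 1" "0 < e" for \<omega> e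
      using AE_sphere_measure_dense[OF kirillov_tuy_points[OF KT assms(4)] that] by (auto simp: D_def)
    fix \<omega> assume "\<omega> \<in> D"
    then have \<omega>: "norm \<omega> = 1" and good: "?good \<omega>"
      by (auto simp: D_def)
    have identity: "(\<integral>y. (y \<bullet> v) * (H \<omega> (?n - 1) (a + y) \<bullet> \<omega>) \<partial>slice \<omega>)
        = real (?n - 1) * (\<integral>y. H \<omega> (?n - 2) (a + y) \<bullet> v \<partial>slice \<omega>)"
      if "a \<in> \<gamma>" "\<omega> \<bullet> v = 0" for a v
    proof -
      obtain T where T: "K \<subseteq> cball a T"
        using bounded_subset_ballD[OF compact_imp_bounded[OF K(1)], of a]
        by (meson ball_subset_cball order_trans)
      show ?thesis
      proof (rule slice_identity[OF \<omega> _ tower K(1) T])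
        show "a \<notin> K"
          using that enc K(2) by (auto simp: encompasses_def)
        show "\<exists>c. (\<integral>t. indicator {0..T} t *\<^sub>R H \<omega> 0 (a + t *\<^sub>R \<xi>) \<partial>lborel) = c *\<^sub>R \<xi>"
          if "1 \<le> norm \<xi>" for \<xi>
          unfolding H0 using K(2) T
          by (intro ray_integral_parallel[OF assms(2,3) cont[OF f(1)] f(2) zero[OF f(1)]
                cont[OF g(1)] g(2) zero[OF g(1)] _ _ enc \<open>a \<in> \<gamma>\<close> data that])
            (auto simp: K_def)
      qed (use dim that in auto)
    qed
    have "AE p in lborel. hyperplane \<omega> p \<inter> B \<noteq> {} \<longrightarrow>
        (\<exists>a\<in>\<gamma> \<inter> hyperplane \<omega> p. \<exists>a'\<in>\<gamma> \<inter> hyperplane \<omega> p. a \<noteq> a')"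
      using good \<omega> by (auto simp: lin_indep_pair_def elim!: eventually_mono)
    then show "AE p in lborel.
        (\<integral>y. H \<omega> (?n - 1) (y + p *\<^sub>R \<omega>) \<bullet> \<omega> \<partial>slice \<omega>) = 0 \<and>
        (\<forall>v. \<omega> \<bullet> v = 0 \<longrightarrow>
          (\<integral>y. (y \<bullet> v) * (H \<omega> (?n - 1) (y + p *\<^sub>R \<omega>) \<bullet> \<omega>) \<partial>slice \<omega>)
          = real (?n - 1) * (\<integral>y. H \<omega> (?n - 2) (y + p *\<^sub>R \<omega>) \<bullet> v \<partial>slice \<omega>))"
    proof eventually_elim
      case (elim p)
      show ?case
      proof (cases "hyperplane \<omega> p \<inter> B = {}")
        case True
        \<comment> \<open>Hyperplanes that miss the domain carry no mass of the field.\<close>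
        have null: "AE y in slice \<omega>. H \<omega> m (y + p *\<^sub>R \<omega>) = 0" for m
          using AE_slice_orthogonal[OF \<omega>]
        proof eventually_elim
          case (elim y)
          then have "y + p *\<^sub>R \<omega> \<in> hyperplane \<omega> p"
            using \<omega> by (simp add: hyperplane_def inner_add_right dot_square_norm)
          then show ?case
            using True K(2) by (intro supp) blast
        qed
        have "(\<integral>y. q y * (H \<omega> m (y + p *\<^sub>R \<omega>) \<bullet> w) \<partial>slice \<omega>) = 0" for q m w
          by (rule integral_eq_zero_AE) (use null[of m] in \<open>auto elim: eventually_mono\<close>)
        from this this[of "\<lambda>_. 1"] show ?thesis
          by simp
      next
        case False
        then obtain a a' where a: "a \<in> \<gamma>" "a' \<in> \<gamma>" "\<omega> \<bullet> a = p" "\<omega> \<bullet> a' = p" "a \<noteq> a'"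
          using elim by (auto simp: hyperplane_def)
        note elimination = two_point_elimination[OF \<omega> tower K(1) a(3-5), of "?n - 1" "real (?n - 1)" "?n - 2"]
        show ?thesis
          using elimination identity a(1,2) by blast
      qed
    qed
  qed (use tower H0 in \<open>auto simp: D_def\<close>)
  then show "f = g"
    by (simp add: fun_eq_iff)
qed

end
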